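(* Let $P\subset\mathbb{R}^n$ be a centrally symmetric polytope (centered at the origin) with nonempty interior, and let $a\in C(\mathbb{T}^n,(0,\infty))$ be non-constant and such that $D_a=P$. Let $g:\mathbb{R}^n\to\mathbb{R}$ be bounded and Lipschitz continuous. For $\varepsilon\in(0,1)$ let $u^\varepsilon$ be the unique viscosity solution of $$u^\varepsilon_t+a\left(\tfrac{x}{\varepsilon}\right)|Du^\varepsilon|=0\ \text{ in }\mathbb{R}^n\times(0,\infty),\qquad u^\varepsilon(x,0)=g(x)\ \text{ on }\mathbb{R}^n,$$ and let $u$ be the viscosity solution of $$u_t+\overline H(Du)=0\ \text{ in }\mathbb{R}^n\times(0,\infty),\qquad u(x,0)=g(x)\ \text{ on }\mathbb{R}^n,$$ where $\overline H(p)=\sup_{q\in D_a}p\cdot q$ for $p\in\mathbb{R}^n$. Then there exists a constant $C>0$ depending only on $a$ such that, for all $\varepsilon\in(0,1)$, $$\|u^\varepsilon-u\|_{L^\infty(\mathbb{R}^n\times[0,\infty))}\le C\varepsilon.$$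
   Context: $\mathbb{T}^n=\mathbb{R}^n/\mathbb{Z}^n$; functions on $\mathbb{T}^n$ are identified with $\mathbb{Z}^n$-periodic functions on $\mathbb{R}^n$. For $a:\mathbb{R}^n\to(0,\infty)$ continuous, $\mathbb{Z}^n$-periodic and non-constant, for $t>0$ and $x\in\mathbb{R}^n$, the reachable set $\mathcal{R}_t(x)$ is the set of all $y\in\mathbb{R}^n$ for which there is $\gamma\in W^{1,\infty}([0,t],\mathbb{R}^n)$ with $\gamma(0)=x$, $\gamma(t)=y$ and $|\dot\gamma(s)|\le a(\gamma(s))$ for a.e. $s\in[0,t]$. It is a known fact that there is a compact convex set $D_a\subset\mathbb{R}^n$, independent of $x$, such that $\frac1t\mathcal{R}_t(x)\to D_a$ as $t\to\infty$ in the Hausdorff distance, for every $x\in\mathbb{R}^n$; this defines $D_a$. The support function $\overline H$ of $D_a$ coincides with the effective Hamiltonian: for each $p\in\mathbb{R}^n$, $\overline H(p)$ is the unique real number such that $a(y)|p+Dv(y)|=\overline H(p)$ in $\mathbb{T}^n$ admits a continuous viscosity solution $v$.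
   Formalization: The bound is proved as C·L·ε, where L is any Lipschitz constant of g and C depends only on a; with Cε and C independent of g the claim fails, since replacing g by λg multiplies the error by λ. *)

theory Defs
  imports "HOL-Analysis.Analysis" "HOL-Probability.Essential_Supremum"
begin

definition Zn_periodic :: "(real ^ 'n \<Rightarrow> real) \<Rightarrow> bool" where
  "Zn_periodic a \<longleftrightarrow> (\<forall>x k. (\<forall>i. k $ i \<in> \<int>) \<longrightarrow> a (x + k) = a x)"

(* Elements of W^{1,infinity}([0,t]) are identified with Lipschitz maps on [0,t], which are
   differentiable almost everywhere with a.e. derivative equal to the weak derivative. *)
definition admissible_path :: "('a::euclidean_space \<Rightarrow> real) \<Rightarrow> real \<Rightarrow> (real \<Rightarrow> 'a) \<Rightarrow> bool" where
  "admissible_path a t \<gamma> \<longleftrightarrow>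
     (\<exists>L. L-lipschitz_on {0..t} \<gamma>) \<and>
     (AE s in lebesgue_on {0..t}.
        \<exists>v. (\<gamma> has_vector_derivative v) (at s within {0..t}) \<and> norm v \<le> a (\<gamma> s))"

definition reachable :: "('a::euclidean_space \<Rightarrow> real) \<Rightarrow> real \<Rightarrow> 'a \<Rightarrow> 'a set" where
  "reachable a t x = {y. \<exists>\<gamma>. admissible_path a t \<gamma> \<and> \<gamma> 0 = x \<and> \<gamma> t = y}"

(* Intended for nonempty sets: infdist x {} = 0. *)
definition hausdorff_dist :: "'a::metric_space set \<Rightarrow> 'a set \<Rightarrow> ennreal" where
  "hausdorff_dist A B =
     max (SUP x\<in>A. ennreal (infdist x B)) (SUP y\<in>B. ennreal (infdist y A))"

definition has_limit_shape :: "('a::euclidean_space \<Rightarrow> real) \<Rightarrow> 'a set \<Rightarrow> bool" where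
  "has_limit_shape a D \<longleftrightarrow>
     compact D \<and> convex D \<and> D \<noteq> {} \<and>
     (\<forall>x. ((\<lambda>t. hausdorff_dist ((\<lambda>y. y /\<^sub>R t) ` reachable a t x) D) \<longlongrightarrow> 0) at_top)"

(* The set D_a; it is determined by has_limit_shape, see limit_shape_eq below. *)
definition limit_shape :: "('a::euclidean_space \<Rightarrow> real) \<Rightarrow> 'a set" where
  "limit_shape a = (THE D. has_limit_shape a D)"

definition support_function :: "'a::real_inner set \<Rightarrow> 'a \<Rightarrow> real" where
  "support_function D p = (SUP q\<in>D. p \<bullet> q)"

definition C1_with_gradient :: "'a::real_inner set \<Rightarrow> ('a \<Rightarrow> real) \<Rightarrow> ('a \<Rightarrow> 'a) \<Rightarrow> bool" where
  "C1_with_gradient U \<phi> G \<longleftrightarrow> (\<forall>z\<in>U. GDERIV \<phi> z :> G z) \<and> continuous_on U G"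

definition local_max_at :: "'a::metric_space set \<Rightarrow> ('a \<Rightarrow> real) \<Rightarrow> 'a \<Rightarrow> bool" where
  "local_max_at U f z \<longleftrightarrow> (\<exists>r>0. \<forall>w \<in> ball z r \<inter> U. f w \<le> f z)"

(* Viscosity solutions of F(z, Dw(z)) = 0 in the open set U. *)

definition viscosity_subsolution ::
    "('a::real_inner \<Rightarrow> 'a \<Rightarrow> real) \<Rightarrow> 'a set \<Rightarrow> ('a \<Rightarrow> real) \<Rightarrow> bool" where
  "viscosity_subsolution F U w \<longleftrightarrow>
     (\<forall>\<phi> G z. C1_with_gradient U \<phi> G \<longrightarrow> z \<in> U \<longrightarrow> local_max_at U (\<lambda>y. w y - \<phi> y) z
        \<longrightarrow> F z (G z) \<le> 0)"

definition viscosity_supersolution ::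
    "('a::real_inner \<Rightarrow> 'a \<Rightarrow> real) \<Rightarrow> 'a set \<Rightarrow> ('a \<Rightarrow> real) \<Rightarrow> bool" where
  "viscosity_supersolution F U w \<longleftrightarrow>
     (\<forall>\<phi> G z. C1_with_gradient U \<phi> G \<longrightarrow> z \<in> U \<longrightarrow> local_max_at U (\<lambda>y. \<phi> y - w y) z
        \<longrightarrow> F z (G z) \<ge> 0)"

definition viscosity_solution ::
    "('a::real_inner \<Rightarrow> 'a \<Rightarrow> real) \<Rightarrow> 'a set \<Rightarrow> ('a \<Rightarrow> real) \<Rightarrow> bool" where
  "viscosity_solution F U w \<longleftrightarrow>
     continuous_on U w \<and> viscosity_subsolution F U w \<and> viscosity_supersolution F U w"

(* The Cauchy problem  w_t + H(x, Dw) = 0 for t > 0,  w(x,0) = g(x).  The space-time gradient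
   of a function of (x,t) is the pair (D_x, d/dt). *)
definition cauchy_viscosity_solution ::
    "('a::euclidean_space \<Rightarrow> 'a \<Rightarrow> real) \<Rightarrow> ('a \<Rightarrow> real) \<Rightarrow> ('a \<times> real \<Rightarrow> real) \<Rightarrow> bool" where
  "cauchy_viscosity_solution H g w \<longleftrightarrow>
     continuous_on (UNIV \<times> {0..}) w \<and>
     viscosity_solution (\<lambda>(x, t) (p, \<tau>). \<tau> + H x p) (UNIV \<times> {0<..}) w \<and>
     (\<forall>x. w (x, 0) = g x)"

definition Linfty_norm :: "'a::euclidean_space set \<Rightarrow> ('a \<Rightarrow> real) \<Rightarrow> ereal" where
  "Linfty_norm S f = esssup (lebesgue_on S) (\<lambda>z. ereal \<bar>f z\<bar>)"

lemma hausdorff_limit_subset: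
  assumes "closed B" "B \<noteq> {}" "C \<noteq> {}"
    and lim1: "((\<lambda>t. hausdorff_dist (A t) B) \<longlongrightarrow> 0) F"
    and lim2: "((\<lambda>t. hausdorff_dist (A t) C) \<longlongrightarrow> 0) F"
    and ne: "eventually (\<lambda>t. A t \<noteq> {}) F" and "F \<noteq> bot"
  shows "C \<subseteq> B"
proof
  fix c assume c: "c \<in> C"
  have "infdist c B \<le> e" if e: "e > 0" for e :: real
  proof -
    have "eventually (\<lambda>t. hausdorff_dist (A t) B < ennreal (e/3)) F"
      "eventually (\<lambda>t. hausdorff_dist (A t) C < ennreal (e/3)) F"
      by (rule order_tendstoD(2)[OF lim1]; use e in simp) (rule order_tendstoD(2)[OF lim2]; use e in simp)
    with ne have "eventually (\<lambda>t. A t \<noteq> {} \<and> hausdorff_dist (A t) B < ennreal (e/3)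
        \<and> hausdorff_dist (A t) C < ennreal (e/3)) F"
      by eventually_elim blast
    then obtain t where t: "A t \<noteq> {}" "hausdorff_dist (A t) B < ennreal (e/3)"
        "hausdorff_dist (A t) C < ennreal (e/3)"
      using \<open>F \<noteq> bot\<close> eventually_happens[of _ F] by blast
    have "ennreal (infdist c (A t)) \<le> hausdorff_dist (A t) C"
      unfolding hausdorff_dist_def by (rule max.coboundedI2, rule SUP_upper[OF c])
    with t(3) have "ennreal (infdist c (A t)) < ennreal (e/3)" by (rule le_less_trans[rotated])
    then have "infdist c (A t) < e/3" by (simp add: ennreal_less_iff infdist_nonneg)
    then obtain y where y: "y \<in> A t" "dist c y < e/3"
      using t(1) cInf_lessD[of "dist c ` A t" "e/3"] by (auto simp: infdist_def)
    have "ennreal (infdist y B) \<le> hausdorff_dist (A t) B"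
      unfolding hausdorff_dist_def by (rule max.coboundedI1, rule SUP_upper[OF y(1)])
    with t(2) have "ennreal (infdist y B) < ennreal (e/3)" by (rule le_less_trans[rotated])
    then have "infdist y B < e/3" by (simp add: ennreal_less_iff infdist_nonneg)
    with y(2) e show ?thesis using infdist_triangle[of c B y] by linarith
  qed
  then have "infdist c B \<le> 0" by (rule field_le_epsilon) simp
  then have "infdist c B = 0" using infdist_nonneg[of c B] by linarith
  then show "c \<in> B"
    using assms(1,2) in_closed_iff_infdist_zero by blast
qed

lemma reachable_nonempty:
  assumes "\<forall>y. a y \<ge> 0"
  shows "reachable a t x \<noteq> {}"
proof -
  have "admissible_path a t (\<lambda>_. x)"
    unfolding admissible_path_def
    using assms by (intro conjI exI[of _ 0] AE_I2 lipschitz_onI) auto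
  then show ?thesis unfolding reachable_def by blast
qed

lemma limit_shape_eq:
  assumes "\<forall>y. a y \<ge> 0" and D: "has_limit_shape a D"
  shows "limit_shape a = D"
proof -
  have sub: "E \<subseteq> D" if "has_limit_shape a D" "has_limit_shape a E" for D E
  proof (rule hausdorff_limit_subset)
    show "((\<lambda>t. hausdorff_dist ((\<lambda>y. y /\<^sub>R t) ` reachable a t 0) D) \<longlongrightarrow> 0) at_top"
      "((\<lambda>t. hausdorff_dist ((\<lambda>y. y /\<^sub>R t) ` reachable a t 0) E) \<longlongrightarrow> 0) at_top"
      using that unfolding has_limit_shape_def by auto
    show "closed D" "D \<noteq> {}" "E \<noteq> {}"
      using that by (simp_all add: has_limit_shape_def compact_imp_closed)
    show "eventually (\<lambda>t. (\<lambda>y. y /\<^sub>R t) ` reachable a t 0 \<noteq> {}) at_top"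
      by (simp add: reachable_nonempty[OF assms(1)])
  qed simp
  show ?thesis unfolding limit_shape_def
    using D sub by (intro the_equality subset_antisym)
qed

end

theory Submission
  imports Defs
begin

text \<open>
  Both solutions are squeezed between values of \<open>g\<close> at points that are reachable in almost the right
  time: comparing a continuous viscosity solution with constant-coefficient cones over short time steps
  gives \<open>u\<^sub>\<epsilon> (x, t) \<le> g y\<close> for \<open>y\<close> reachable from \<open>x\<close> in time \<open>t\<close>, and \<open>g y \<le> u\<^sub>\<epsilon> (x, t)\<close> for some \<open>y\<close>
  reachable in time \<open>(1 + \<eta>)\<^sup>3 t\<close>; no comparison principle is needed. For \<open>u\<close> this is the Hopf--Lax formula,
  with \<open>x + t P\<close> as reachable set. It remains to see that the reachable set in time \<open>t\<close> stays within a
  bounded distance of \<open>x + t P\<close>. Rounding an end point to an integer vector and repeating the path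
  periodically gives one inclusion. Conversely, a vertex \<open>v\<close> of \<open>P\<close> is exposed by some \<open>p\<close> with
  \<open>|v - q| \<le> K p \<bullet> (v - q)\<close> on \<open>P\<close>, so a path that is almost optimal in direction \<open>p\<close> must end near
  \<open>t v\<close>; a general point of \<open>t P\<close> is approximated by concatenating such paths for the vertices.
\<close>

section \<open>Reachable sets\<close>

text \<open>A mean value inequality that tolerates a null set. If it failed, a tilted function
  \<open>\<psi>\<close> would rise from \<open>a\<close> to \<open>b\<close> although its derivative
  is negative off \<open>N\<close>. Lipschitz maps send \<open>N\<close> to a null set, so some
  level between \<open>\<psi> a\<close> and \<open>\<psi> b\<close> is not attained on
  \<open>N\<close>; at the last crossing of that level \<open>\<psi>\<close> cannot be
  decreasing.\<close>

lemma lipschitz_increment_le: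
  fixes f :: "real \<Rightarrow> real"
  assumes "a \<le> b" and lip: "L-lipschitz_on {a..b} f" and N: "negligible N"
    and deriv: "\<And>s. s \<in> {a<..<b} - N \<Longrightarrow> \<exists>v. (f has_real_derivative v) (at s) \<and> v \<le> M"
  shows "f b - f a \<le> M * (b - a)"
proof (rule ccontr)
  assume "\<not> ?thesis"
  then have neg: "f b - f a > M * (b - a)" and "a < b"
    using \<open>a \<le> b\<close> by (cases "a = b"; simp)+
  \<comment> \<open>Half of the excess slope: \<open>\<psi>\<close> still rises over the interval,
    yet its derivative is at most \<open>- e\<close> off \<open>N\<close>.\<close>
  define e where "e = (f b - f a - M * (b - a)) / (2 * (b - a))"
  have "e > 0" using neg \<open>a < b\<close> by (simp add: e_def)
  define \<psi> where "\<psi> = (\<lambda>s. f s - (M + e) * s)"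
  have "\<psi> a < \<psi> b"
  proof -
    have "e * (b - a) = (f b - f a - M * (b - a)) / 2"
      using nonzero_mult_div_cancel_right[of "b - a" "(f b - f a - M * (b - a)) / 2"] \<open>a < b\<close>
      by (simp add: e_def divide_simps)
    then show ?thesis using neg by (simp add: \<psi>_def algebra_simps)
  qed
  have cont: "continuous_on {a..b} \<psi>"
    unfolding \<psi>_def by (intro continuous_intros lipschitz_on_continuous_on[OF lip])
  have "negligible (\<psi> ` (N \<inter> {a..b}))"
  proof (rule negligible_locally_Lipschitz_image)
    show "negligible (N \<inter> {a..b})" using N by (simp add: negligible_Int)
    fix x assume x: "x \<in> N \<inter> {a..b}"
    have "norm (\<psi> y - \<psi> x) \<le> (L + \<bar>M + e\<bar>) * norm (y - x)" if "y \<in> N \<inter> {a..b}" for y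
    proof -
      have "\<bar>f y - f x\<bar> \<le> L * \<bar>y - x\<bar>"
        using lipschitz_onD[OF lip, of y x] x that by (simp add: dist_real_def)
      moreover have "\<bar>\<psi> y - \<psi> x\<bar> \<le> \<bar>f y - f x\<bar> + \<bar>M + e\<bar> * \<bar>y - x\<bar>"
        unfolding \<psi>_def abs_mult[symmetric] right_diff_distrib by linarith
      ultimately show ?thesis by (simp add: distrib_right)
    qed
    then show "\<exists>T B. open T \<and> x \<in> T \<and> (\<forall>y\<in>N \<inter> {a..b} \<inter> T. norm (\<psi> y - \<psi> x) \<le> B * norm (y - x))"
      by (intro exI[of _ UNIV] exI[of _ "L + \<bar>M + e\<bar>"]) auto
  qed simp
  moreover have "\<not> negligible {\<psi> a<..<\<psi> b}"
    using \<open>\<psi> a < \<psi> b\<close> by (intro open_not_negligible) auto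
  ultimately obtain c where c: "\<psi> a < c" "c < \<psi> b" "c \<notin> \<psi> ` (N \<inter> {a..b})"
    by (metis negligible_subset greaterThanLessThan_iff subsetI)
  \<comment> \<open>The largest element of \<open>A\<close> is the last time with
    \<open>\<psi> \<le> c\<close>; by the intermediate value theorem \<open>\<psi> = c\<close>
    there.\<close>
  define A where "A = {a..b} \<inter> \<psi> -` {..c}"
  have "compact A"
    unfolding A_def compact_eq_bounded_closed
    using continuous_closed_preimage[OF cont] by (auto intro: bounded_subset[OF bounded_closed_interval])
  moreover have "a \<in> A" using c \<open>a < b\<close> by (simp add: A_def)
  ultimately obtain s where s: "s \<in> A" "\<And>r. r \<in> A \<Longrightarrow> r \<le> s"
    using compact_attains_sup[of A] by auto
  have sab: "a \<le> s" "s \<le> b" "\<psi> s \<le> c" using s(1) by (auto simp: A_def)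
  obtain r where r: "s \<le> r" "r \<le> b" "\<psi> r = c"
    using IVT'[of \<psi> s c b] sab c continuous_on_subset[OF cont, of "{s..b}"] by auto
  then have "r = s" using s(2)[of r] sab by (simp add: A_def)
  then have sc: "\<psi> s = c" using r by simp
  then have "a < s" "s < b" using c sab by (metis order_le_less less_irrefl)+
  moreover have "s \<notin> N" using c(3) sc sab by auto
  ultimately obtain v where v: "(f has_real_derivative v) (at s)" "v \<le> M"
    using deriv[of s] by auto
  have "(\<psi> has_real_derivative (v - (M + e))) (at s)"
    unfolding \<psi>_def by (rule derivative_eq_intros v refl | simp)+
  then obtain d where d: "d > 0" "\<And>h. 0 < h \<Longrightarrow> h < d \<Longrightarrow> \<psi> (s + h) < \<psi> s"
    using DERIV_neg_dec_right[of \<psi> _ s] v(2) \<open>e > 0\<close> by fastforce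
  define h where "h = min (d / 2) (b - s)"
  have "0 < h" "h < d" "s + h \<le> b" using d \<open>s < b\<close> by (auto simp: h_def)
  then have "s + h \<in> A" using d(2)[of h] sc sab by (simp add: A_def)
  with s(2) \<open>0 < h\<close> show False by force
qed

text \<open>Testing the curve against its own increment \<open>e\<close> reduces this to the scalar
  case: the slope is at most \<open>norm e * M\<close>, and one factor \<open>norm e\<close> cancels
  at the end.\<close>

lemma lipschitz_norm_increment_le:
  fixes \<gamma> :: "real \<Rightarrow> 'a::euclidean_space"
  assumes "a \<le> b" and lip: "L-lipschitz_on {a..b} \<gamma>" and N: "negligible N"
    and deriv: "\<And>s. s \<in> {a<..<b} - N \<Longrightarrow>
      \<exists>v. (\<gamma> has_vector_derivative v) (at s) \<and> norm v \<le> M"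
  shows "norm (\<gamma> b - \<gamma> a) \<le> M * (b - a)"
proof (cases "\<gamma> b = \<gamma> a")
  case True
  show ?thesis
  proof (cases "a = b")
    case False
    \<comment> \<open>With zero increment the claim is \<open>0 \<le> M\<close>, which any single
      point outside \<open>N\<close> provides.\<close>
    then have "{a<..<b} - N \<noteq> {}"
      using open_not_negligible[of "{a<..<b}"] \<open>a \<le> b\<close> negligible_subset[OF N] by fastforce
    then have "M \<ge> 0" using deriv by (meson ex_in_conv norm_ge_zero order_trans)
    then show ?thesis using True \<open>a \<le> b\<close> by simp
  qed simp
next
  case False
  define e where "e = \<gamma> b - \<gamma> a"
  have "e \<bullet> \<gamma> b - e \<bullet> \<gamma> a \<le> (norm e * M) * (b - a)"
  proof (rule lipschitz_increment_le[OF \<open>a \<le> b\<close> _ N])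
    show "(norm e * L)-lipschitz_on {a..b} (\<lambda>s. e \<bullet> \<gamma> s)"
    proof (rule lipschitz_onI)
      fix x y assume "x \<in> {a..b}" "y \<in> {a..b}"
      then have "norm (\<gamma> x - \<gamma> y) \<le> L * dist x y"
        using lipschitz_onD[OF lip] by (simp add: dist_norm)
      then have "norm e * norm (\<gamma> x - \<gamma> y) \<le> norm e * (L * dist x y)"
        by (simp add: mult_left_mono)
      moreover have "dist (e \<bullet> \<gamma> x) (e \<bullet> \<gamma> y) \<le> norm e * norm (\<gamma> x - \<gamma> y)"
        by (simp add: dist_real_def inner_diff_right[symmetric] Cauchy_Schwarz_ineq2)
      ultimately show "dist (e \<bullet> \<gamma> x) (e \<bullet> \<gamma> y) \<le> norm e * L * dist x y"
        by (simp add: mult.assoc)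
    qed (simp add: lipschitz_on_nonneg[OF lip])
    fix s assume "s \<in> {a<..<b} - N"
    then obtain v where v: "(\<gamma> has_vector_derivative v) (at s)" "norm v \<le> M"
      using deriv by blast
    have "((\<lambda>s. e \<bullet> \<gamma> s) has_vector_derivative e \<bullet> v) (at s)"
      using bounded_linear.has_vector_derivative[OF bounded_linear_inner_right v(1)] .
    moreover have "e \<bullet> v \<le> norm e * M"
      using norm_cauchy_schwarz[of e v] mult_left_mono[OF v(2) norm_ge_zero[of e]] by linarith
    ultimately show "\<exists>v. ((\<lambda>s. e \<bullet> \<gamma> s) has_real_derivative v) (at s) \<and> v \<le> norm e * M"
      by (auto simp: has_real_derivative_iff_has_vector_derivative)
  qed
  then have "norm e * norm e \<le> norm e * (M * (b - a))"
    by (simp add: e_def[symmetric] inner_diff_right[symmetric] power2_norm_eq_inner[symmetric] power2_eq_square mult.assoc)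
  then show ?thesis using False by (simp add: e_def)
qed

text \<open>An explicit null set and two-sided derivatives at interior times are convenient for
  gluing and reparametrising; the two end points are absorbed by the null set.\<close>

lemma admissible_path_iff:
  "admissible_path a t \<gamma> \<longleftrightarrow> (\<exists>L. L-lipschitz_on {0..t} \<gamma>) \<and>
     (\<exists>N. negligible N \<and> (\<forall>s\<in>{0<..<t} - N.
        \<exists>v. (\<gamma> has_vector_derivative v) (at s) \<and> norm v \<le> a (\<gamma> s)))"
proof -
  let ?P = "\<lambda>s. \<exists>v. (\<gamma> has_vector_derivative v) (at s within {0..t}) \<and> norm v \<le> a (\<gamma> s)"
  let ?Q = "\<lambda>s. \<exists>v. (\<gamma> has_vector_derivative v) (at s) \<and> norm v \<le> a (\<gamma> s)"
  have PQ: "?P s = ?Q s" if "s \<in> {0<..<t}" for s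
  proof -
    have "at s within {0..t} = at s"
      using that by (intro at_within_interior) auto
    then show ?thesis by simp
  qed
  have "(AE s in lebesgue_on {0..t}. ?P s) \<longleftrightarrow> (AE s in lebesgue. s \<in> {0..t} \<longrightarrow> ?P s)"
    by (rule AE_restrict_space_iff) simp
  also have "\<dots> \<longleftrightarrow> (\<exists>N. negligible N \<and> {s. \<not> (s \<in> {0..t} \<longrightarrow> ?P s)} \<subseteq> N)"
    unfolding eventually_ae_filter_negligible by (rule refl)
  also have "\<dots> \<longleftrightarrow> (\<exists>N. negligible N \<and> (\<forall>s\<in>{0<..<t} - N. ?Q s))"
  proof
    assume "\<exists>N. negligible N \<and> {s. \<not> (s \<in> {0..t} \<longrightarrow> ?P s)} \<subseteq> N"
    then obtain N where N: "negligible N" "{s. \<not> (s \<in> {0..t} \<longrightarrow> ?P s)} \<subseteq> N" by blast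
    have "?Q s" if "s \<in> {0<..<t} - N" for s
    proof -
      have "s \<notin> {s. \<not> (s \<in> {0..t} \<longrightarrow> ?P s)}"
        using that by (intro contra_subsetD[OF N(2)]) simp
      moreover have "s \<in> {0..t}" using that by simp
      ultimately have "?P s" by blast
      then show ?thesis using PQ that by blast
    qed
    with N(1) show "\<exists>N. negligible N \<and> (\<forall>s\<in>{0<..<t} - N. ?Q s)" by blast
  next
    assume "\<exists>N. negligible N \<and> (\<forall>s\<in>{0<..<t} - N. ?Q s)"
    then obtain N where N: "negligible N" "\<And>s. s \<in> {0<..<t} - N \<Longrightarrow> ?Q s" by blast
    have "?P s" if "s \<in> {0..t}" "s \<notin> insert 0 (insert t N)" for s
      using N(2)[of s] PQ[of s] that by force
    then have "{s. \<not> (s \<in> {0..t} \<longrightarrow> ?P s)} \<subseteq> insert 0 (insert t N)" by blast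
    moreover have "negligible (insert 0 (insert t N))" using N(1) by simp
    ultimately show "\<exists>N. negligible N \<and> {s. \<not> (s \<in> {0..t} \<longrightarrow> ?P s)} \<subseteq> N" by blast
  qed
  finally show ?thesis unfolding admissible_path_def by blast
qed

lemma reachableI:
  assumes "L-lipschitz_on {0..t} \<gamma>" "negligible N" "\<gamma> 0 = x" "\<gamma> t = y"
    and "\<And>s. 0 < s \<Longrightarrow> s < t \<Longrightarrow> s \<notin> N \<Longrightarrow>
      \<exists>v. (\<gamma> has_vector_derivative v) (at s) \<and> norm v \<le> a (\<gamma> s)"
  shows "y \<in> reachable a t x"
proof -
  have "admissible_path a t \<gamma>"
    unfolding admissible_path_iff
    by (intro conjI exI[of _ L] exI[of _ N] assms ballI) (use assms(5) in auto)
  then show ?thesis using assms(3,4) by (auto simp: reachable_def)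
qed

lemma reachableE:
  assumes "y \<in> reachable a t x"
  obtains L \<gamma> N where "L-lipschitz_on {0..t} \<gamma>" "negligible N" "\<gamma> 0 = x" "\<gamma> t = y"
    and "\<And>s. 0 < s \<Longrightarrow> s < t \<Longrightarrow> s \<notin> N \<Longrightarrow>
      \<exists>v. (\<gamma> has_vector_derivative v) (at s) \<and> norm v \<le> a (\<gamma> s)"
  using assms unfolding reachable_def admissible_path_iff by fastforce

section \<open>Operations on reachable sets\<close>

lemma has_vector_derivative_compose_affine:
  fixes \<gamma> :: "real \<Rightarrow> 'a::real_normed_vector"
  assumes "(\<gamma> has_vector_derivative v) (at (c * s + d))"
  shows "((\<lambda>r. \<gamma> (c * r + d)) has_vector_derivative c *\<^sub>R v) (at s)"
proof -
  have "((\<lambda>r. c * r + d) has_real_derivative c) (at s)"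
    by (auto intro!: derivative_eq_intros)
  from vector_diff_chain_at[OF this[unfolded has_real_derivative_iff_has_vector_derivative] assms]
  show ?thesis by (simp add: o_def)
qed

lemma negligible_affine_preimage:
  fixes N :: "real set"
  assumes "negligible N" "c \<noteq> 0"
  shows "negligible {s. c * s + d \<in> N}"
proof -
  have "{s. c * s + d \<in> N} \<subseteq> (\<lambda>r. (r - d) / c) ` N"
    using assms(2) by (auto intro!: image_eqI[where x="c * _ + d"])
  moreover have "negligible ((\<lambda>r. (r - d) / c) ` N)"
  proof (rule negligible_locally_Lipschitz_image)
    fix x assume "x \<in> N"
    have "norm ((y - d) / c - (x - d) / c) \<le> (1 / \<bar>c\<bar>) * norm (y - x)" for y
      by (simp add: diff_divide_distrib[symmetric])
    then show "\<exists>T B. open T \<and> x \<in> T \<and>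
        (\<forall>y\<in>N \<inter> T. norm ((y - d) / c - (x - d) / c) \<le> B * norm (y - x))"
      by (intro exI[of _ UNIV] exI[of _ "1 / \<bar>c\<bar>"]) auto
  qed (use assms in auto)
  ultimately show ?thesis using negligible_subset by blast
qed

lemma reachable_trans:
  assumes "y \<in> reachable a t x" "z \<in> reachable a s y" "0 \<le> t" "0 \<le> s"
  shows "z \<in> reachable a (t + s) x"
proof -
  obtain L \<gamma> N where 1: "L-lipschitz_on {0..t} \<gamma>" "negligible N" "\<gamma> 0 = x" "\<gamma> t = y"
    and d1: "\<And>r. 0 < r \<Longrightarrow> r < t \<Longrightarrow> r \<notin> N \<Longrightarrow>
      \<exists>v. (\<gamma> has_vector_derivative v) (at r) \<and> norm v \<le> a (\<gamma> r)"
    using assms(1) by (rule reachableE) blast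
  obtain L' \<gamma>' N' where 2: "L'-lipschitz_on {0..s} \<gamma>'" "negligible N'" "\<gamma>' 0 = y" "\<gamma>' s = z"
    and d2: "\<And>r. 0 < r \<Longrightarrow> r < s \<Longrightarrow> r \<notin> N' \<Longrightarrow>
      \<exists>v. (\<gamma>' has_vector_derivative v) (at r) \<and> norm v \<le> a (\<gamma>' r)"
    using assms(2) by (rule reachableE) blast
  \<comment> \<open>The affine form \<open>1 * r + (- t)\<close> matches
    \<open>has_vector_derivative_compose_affine\<close> and
    \<open>negligible_affine_preimage\<close>.\<close>
  define \<Gamma> where "\<Gamma> = (\<lambda>r. if r \<le> t then \<gamma> r else \<gamma>' (1 * r + (- t)))"
  show ?thesis
  proof (rule reachableI)
    have "(max L L')-lipschitz_on {t..t + s} (\<lambda>r. \<gamma>' (1 * r + (- t)))"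
    proof (rule lipschitz_onI)
      fix p q assume "p \<in> {t..t + s}" "q \<in> {t..t + s}"
      then have "dist (\<gamma>' (1 * p + (- t))) (\<gamma>' (1 * q + (- t))) \<le> L' * dist p q"
        using lipschitz_onD[OF 2(1), of "p - t" "q - t"] by (simp add: dist_real_def)
      also have "\<dots> \<le> max L L' * dist p q" by (simp add: mult_right_mono)
      finally show "dist (\<gamma>' (1 * p + (- t))) (\<gamma>' (1 * q + (- t))) \<le> max L L' * dist p q" .
    qed (simp add: lipschitz_on_nonneg[OF 2(1)] max.coboundedI2)
    then show "(max L L')-lipschitz_on {0..t + s} \<Gamma>"
      unfolding \<Gamma>_def using lipschitz_on_le[OF 1(1), of "max L L'"] 1(4) 2(3)
      by (intro lipschitz_on_concat) auto
    \<comment> \<open>The junction \<open>t\<close> is exceptional because the one-sided derivatives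
      of the two pieces need not agree there.\<close>
    show "negligible (insert t (N \<union> {r. 1 * r + (- t) \<in> N'}))"
      using 1(2) negligible_affine_preimage[OF 2(2), of 1 "- t"] by simp
    show "\<Gamma> 0 = x" "\<Gamma> (t + s) = z"
      using 1 2 assms(3,4) by (auto simp: \<Gamma>_def)
    fix r assume r: "0 < r" "r < t + s" "r \<notin> insert t (N \<union> {r. 1 * r + (- t) \<in> N'})"
    show "\<exists>v. (\<Gamma> has_vector_derivative v) (at r) \<and> norm v \<le> a (\<Gamma> r)"
    proof (cases "r < t")
      case True
      then obtain v where "(\<gamma> has_vector_derivative v) (at r)" "norm v \<le> a (\<gamma> r)"
        using d1 r by auto
      moreover have "\<And>q. q \<in> {..<t} \<Longrightarrow> \<gamma> q = \<Gamma> q" by (auto simp: \<Gamma>_def)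
      ultimately show ?thesis
        using has_vector_derivative_transform_within_open[of \<gamma> v r "{..<t}" \<Gamma>] True by auto
    next
      case False
      then have "t < r" using r by auto
      then obtain v where v: "(\<gamma>' has_vector_derivative v) (at (1 * r + (- t)))" "norm v \<le> a (\<gamma>' (1 * r + (- t)))"
        using d2[of "1 * r + (- t)"] r by auto
      have "\<And>q. q \<in> {t<..} \<Longrightarrow> \<gamma>' (1 * q + (- t)) = \<Gamma> q" by (auto simp: \<Gamma>_def)
      with has_vector_derivative_compose_affine[OF v(1)] v(2) \<open>t < r\<close> show ?thesis
        using has_vector_derivative_transform_within_open[of "\<lambda>r. \<gamma>' (1 * r + (- t))" "1 *\<^sub>R v" r "{t<..}" \<Gamma>]
        by auto
    qed
  qed
qed

lemma reachable_split:
  assumes "z \<in> reachable a (t + s) x" "0 \<le> t" "0 \<le> s"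
  obtains y where "y \<in> reachable a t x" "z \<in> reachable a s y"
proof -
  obtain L \<gamma> N where 1: "L-lipschitz_on {0..t + s} \<gamma>" "negligible N" "\<gamma> 0 = x" "\<gamma> (t + s) = z"
    and d1: "\<And>r. 0 < r \<Longrightarrow> r < t + s \<Longrightarrow> r \<notin> N \<Longrightarrow>
      \<exists>v. (\<gamma> has_vector_derivative v) (at r) \<and> norm v \<le> a (\<gamma> r)"
    using assms(1) by (rule reachableE) blast
  have "\<gamma> t \<in> reachable a t x"
    using assms 1 d1 by (intro reachableI[of L _ \<gamma> N] lipschitz_on_subset[OF 1(1)]) auto
  moreover have "z \<in> reachable a s (\<gamma> t)"
  proof (rule reachableI)
    show "L-lipschitz_on {0..s} (\<lambda>r. \<gamma> (1 * r + t))"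
    proof (rule lipschitz_onI)
      fix p q assume "p \<in> {0..s}" "q \<in> {0..s}"
      then show "dist (\<gamma> (1 * p + t)) (\<gamma> (1 * q + t)) \<le> L * dist p q"
        using lipschitz_onD[OF 1(1), of "p + t" "q + t"] assms(2) by (simp add: dist_real_def)
    qed (rule lipschitz_on_nonneg[OF 1(1)])
    show "negligible {r. 1 * r + t \<in> N}"
      using negligible_affine_preimage[OF 1(2), of 1 t] by simp
    fix r assume r: "0 < r" "r < s" "r \<notin> {r. 1 * r + t \<in> N}"
    then obtain v where "(\<gamma> has_vector_derivative v) (at (1 * r + t))" "norm v \<le> a (\<gamma> (1 * r + t))"
      using d1[of "1 * r + t"] assms(2) by auto
    then show "\<exists>v. ((\<lambda>r. \<gamma> (1 * r + t)) has_vector_derivative v) (at r) \<and> norm v \<le> a (\<gamma> (1 * r + t))"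
      using has_vector_derivative_compose_affine[of \<gamma> v 1 r t] by auto
  qed (use 1 in \<open>auto simp: add.commute\<close>)
  ultimately show ?thesis by (rule that)
qed

lemma reachable_translate:
  assumes "y \<in> reachable a t x" and a: "\<And>z. a (z + k) = a z"
  shows "y + k \<in> reachable a t (x + k)"
proof -
  obtain L \<gamma> N where 1: "L-lipschitz_on {0..t} \<gamma>" "negligible N" "\<gamma> 0 = x" "\<gamma> t = y"
    and d1: "\<And>r. 0 < r \<Longrightarrow> r < t \<Longrightarrow> r \<notin> N \<Longrightarrow>
      \<exists>v. (\<gamma> has_vector_derivative v) (at r) \<and> norm v \<le> a (\<gamma> r)"
    using assms(1) by (rule reachableE) blast
  show ?thesis
  proof (rule reachableI[OF _ 1(2)])
    show "L-lipschitz_on {0..t} (\<lambda>r. \<gamma> r + k)"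
      using 1(1) by (simp add: lipschitz_on_def)
    show "\<exists>v. ((\<lambda>r. \<gamma> r + k) has_vector_derivative v) (at s) \<and> norm v \<le> a (\<gamma> s + k)"
      if "0 < s" "s < t" "s \<notin> N" for s
      using d1[OF that] a by (auto intro: has_vector_derivative_add_const[THEN iffD2])
  qed (use 1 in auto)
qed

text \<open>Scaling space and time by the same factor leaves velocities unchanged.\<close>

lemma reachable_scale:
  assumes "y \<in> reachable a t x" and "c > 0" and b: "\<And>z. b (c *\<^sub>R z) = a z"
  shows "c *\<^sub>R y \<in> reachable b (c * t) (c *\<^sub>R x)"
proof -
  obtain L \<gamma> N where 1: "L-lipschitz_on {0..t} \<gamma>" "negligible N" "\<gamma> 0 = x" "\<gamma> t = y"
    and d1: "\<And>r. 0 < r \<Longrightarrow> r < t \<Longrightarrow> r \<notin> N \<Longrightarrow>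
      \<exists>v. (\<gamma> has_vector_derivative v) (at r) \<and> norm v \<le> a (\<gamma> r)"
    using assms(1) by (rule reachableE) blast
  show ?thesis
  proof (rule reachableI)
    show "L-lipschitz_on {0..c * t} (\<lambda>r. c *\<^sub>R \<gamma> (1/c * r + 0))"
    proof (rule lipschitz_onI)
      fix p q assume "p \<in> {0..c * t}" "q \<in> {0..c * t}"
      then have "dist (\<gamma> (p / c)) (\<gamma> (q / c)) \<le> L * dist (p / c) (q / c)"
        using \<open>c > 0\<close> by (intro lipschitz_onD[OF 1(1)]) (auto simp: field_simps)
      also have "dist (p / c) (q / c) = dist p q / c"
        using \<open>c > 0\<close> by (simp add: dist_real_def diff_divide_distrib[symmetric])
      finally have "c * dist (\<gamma> (p / c)) (\<gamma> (q / c)) \<le> L * dist p q"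
        using \<open>c > 0\<close> by (simp add: field_simps)
      then show "dist (c *\<^sub>R \<gamma> (1/c * p + 0)) (c *\<^sub>R \<gamma> (1/c * q + 0)) \<le> L * dist p q"
        using \<open>c > 0\<close> by (simp add: dist_norm scaleR_diff_right[symmetric])
    qed (rule lipschitz_on_nonneg[OF 1(1)])
    show "negligible {r. 1/c * r + 0 \<in> N}"
      using \<open>c > 0\<close> by (intro negligible_affine_preimage 1) auto
    fix r assume r: "0 < r" "r < c * t" "r \<notin> {r. 1/c * r + 0 \<in> N}"
    then obtain v where v: "(\<gamma> has_vector_derivative v) (at (1/c * r + 0))" "norm v \<le> a (\<gamma> (1/c * r + 0))"
      using d1[of "1/c * r + 0"] \<open>c > 0\<close> by (auto simp: field_simps)
    have "((\<lambda>r. c *\<^sub>R \<gamma> (1/c * r + 0)) has_vector_derivative c *\<^sub>R (1/c) *\<^sub>R v) (at r)"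
      by (intro bounded_linear.has_vector_derivative[OF bounded_linear_scaleR_right]
          has_vector_derivative_compose_affine v)
    then show "\<exists>v. ((\<lambda>r. c *\<^sub>R \<gamma> (1/c * r + 0)) has_vector_derivative v) (at r) \<and>
        norm v \<le> b (c *\<^sub>R \<gamma> (1/c * r + 0))"
      using v(2) \<open>c > 0\<close> b by auto
  qed (use 1 \<open>c > 0\<close> in auto)
qed

lemma reachable_segment:
  assumes "norm (y - x) \<le> m * t" "0 \<le> t" and m: "\<And>z. z \<in> closed_segment x y \<Longrightarrow> m \<le> a z"
  shows "y \<in> reachable a t x"
proof (rule reachableI)
  let ?\<gamma> = "\<lambda>s. x + (s / t) *\<^sub>R (y - x)"
  show "(norm (y - x) / t)-lipschitz_on {0..t} ?\<gamma>"
  proof (rule lipschitz_onI)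
    fix p q
    have "?\<gamma> p - ?\<gamma> q = ((p - q) / t) *\<^sub>R (y - x)"
      by (simp add: algebra_simps diff_divide_distrib)
    then show "dist (?\<gamma> p) (?\<gamma> q) \<le> norm (y - x) / t * dist p q"
      using assms(2) unfolding dist_norm by (simp add: mult.commute)
  qed (use assms in auto)
  show "negligible ({} :: real set)" "?\<gamma> 0 = x" by auto
  \<comment> \<open>For \<open>t = 0\<close> the norm bound forces \<open>y = x\<close>.\<close>
  show "?\<gamma> t = y" using assms by (cases "t = 0") auto
  fix s assume s: "0 < s" "s < t"
  have "(?\<gamma> has_vector_derivative (1 / t) *\<^sub>R (y - x)) (at s)"
  proof -
    have "((\<lambda>r. x + r *\<^sub>R (y - x)) has_vector_derivative y - x) (at (1 / t * s + 0))"
      by (auto intro!: derivative_eq_intros)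
    from has_vector_derivative_compose_affine[OF this] show ?thesis by simp
  qed
  moreover have "norm ((1 / t) *\<^sub>R (y - x)) \<le> m"
    using assms s by (simp add: pos_divide_le_eq del: scaleR_right_diff_distrib)
  moreover have "?\<gamma> s \<in> closed_segment x y"
    using s by (auto simp: in_segment algebra_simps intro!: exI[of _ "s / t"])
  ultimately show "\<exists>v. (?\<gamma> has_vector_derivative v) (at s) \<and> norm v \<le> a (?\<gamma> s)"
    using m by force
qed

lemma reachable_norm_le:
  assumes "y \<in> reachable a t x" "0 \<le> t" and M: "\<And>z. a z \<le> M"
  shows "norm (y - x) \<le> M * t"
proof -
  obtain L \<gamma> N where 1: "L-lipschitz_on {0..t} \<gamma>" "negligible N" "\<gamma> 0 = x" "\<gamma> t = y"
    and d1: "\<And>r. 0 < r \<Longrightarrow> r < t \<Longrightarrow> r \<notin> N \<Longrightarrow>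
      \<exists>v. (\<gamma> has_vector_derivative v) (at r) \<and> norm v \<le> a (\<gamma> r)"
    using assms(1) by (rule reachableE) blast
  have "norm (\<gamma> t - \<gamma> 0) \<le> M * (t - 0)"
    using assms(2) 1(1,2)
  proof (rule lipschitz_norm_increment_le)
    fix s assume "s \<in> {0<..<t} - N"
    then show "\<exists>v. (\<gamma> has_vector_derivative v) (at s) \<and> norm v \<le> M"
      using d1[of s] M[of "\<gamma> s"] by fastforce
  qed
  then show ?thesis using 1 by simp
qed

text \<open>A bootstrap: the crude bound \<open>M\<close> confines the path to the ball of radius
  \<open>M * t\<close> around \<open>x\<close>, and there the sharper bound \<open>m\<close>
  controls the speed.\<close>

lemma reachable_norm_le_local:
  assumes "y \<in> reachable a t x" "0 \<le> t" and M: "\<And>z. a z \<le> M"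
    and m: "\<And>z. norm (z - x) \<le> M * t \<Longrightarrow> a z \<le> m"
  shows "norm (y - x) \<le> m * t"
proof -
  obtain L \<gamma> N where 1: "L-lipschitz_on {0..t} \<gamma>" "negligible N" "\<gamma> 0 = x" "\<gamma> t = y"
    and d1: "\<And>r. 0 < r \<Longrightarrow> r < t \<Longrightarrow> r \<notin> N \<Longrightarrow>
      \<exists>v. (\<gamma> has_vector_derivative v) (at r) \<and> norm v \<le> a (\<gamma> r)"
    using assms(1) by (rule reachableE) blast
  have near: "norm (\<gamma> s - x) \<le> M * t" if s: "0 < s" "s < t" "s \<notin> N" for s
  proof -
    have "\<gamma> s \<in> reachable a s x"
      using s 1 d1 by (intro reachableI[of L _ \<gamma> N] lipschitz_on_subset[OF 1(1)]) auto
    then have "norm (\<gamma> s - x) \<le> M * s" using s M by (intro reachable_norm_le) auto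
    moreover have "0 \<le> M" using d1[OF s] M[of "\<gamma> s"] by (meson norm_ge_zero order_trans)
    ultimately show ?thesis using s by (meson less_imp_le mult_left_mono order_trans)
  qed
  have "norm (\<gamma> t - \<gamma> 0) \<le> m * (t - 0)"
    using assms(2) 1(1,2)
  proof (rule lipschitz_norm_increment_le)
    fix s assume "s \<in> {0<..<t} - N"
    then show "\<exists>v. (\<gamma> has_vector_derivative v) (at s) \<and> norm v \<le> m"
      using d1[of s] m[OF near[of s]] by fastforce
  qed
  then show ?thesis using 1 by simp
qed

lemma reachable_refl: "0 \<le> t \<Longrightarrow> (\<And>z. 0 \<le> a z) \<Longrightarrow> x \<in> reachable a t x"
  by (rule reachable_segment[of x x 0]) auto

section \<open>Viscosity solutions and cones\<close>

text \<open>This is the test function of the cone comparison with \<open>k\<close> frozen; the first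
  component of its gradient is spatial, the second is the time derivative.\<close>

lemma GDERIV_cone_test:
  fixes X k :: "'a::real_inner"
  shows "GDERIV (\<lambda>(x, t). - A * (norm (x - X + (T - t) *\<^sub>R k))\<^sup>2 - \<delta> * exp (l * (t - s))) (x, t) :>
     (- 2 * A) *\<^sub>R (x - X + (T - t) *\<^sub>R k, - ((x - X + (T - t) *\<^sub>R k) \<bullet> k)) - (0, \<delta> * l * exp (l * (t - s)))"
  unfolding gderiv_def power2_norm_eq_inner split_beta
  by (auto intro!: derivative_eq_intros ext simp: inner_commute inner_Pair algebra_simps)

text \<open>Minimise \<open>w (x, t) + A |x - X + (T - t) k|\<^sup>2 + \<delta> exp (l (t - t0))\<close> jointly in \<open>(x, t, k)\<close>. Freezing the
  optimal \<open>k\<close> gives a smooth test function, so the squared distance to the cone, which need not be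
  differentiable, never has to be differentiated; optimality of \<open>k\<close> makes \<open>k\<close> a maximiser of
  \<open>p \<bullet> k'\<close> over \<open>K\<close> for the spatial gradient \<open>p\<close>.\<close>

lemma supersolution_cone:
  fixes w :: "'a::euclidean_space \<times> real \<Rightarrow> real"
  assumes K: "compact K" "convex K"
    and cont: "continuous_on (UNIV \<times> {0..}) w"
    and super: "viscosity_supersolution F (UNIV \<times> {0<..}) w"
    and time: "0 \<le> s" "s < t0" "t0 < T"
    and "\<rho> > 0"
    and F: "\<And>x t k p \<tau>. s < t \<Longrightarrow> t < T \<Longrightarrow> k \<in> K \<Longrightarrow> norm (x - X + (T - t) *\<^sub>R k) < \<rho> \<Longrightarrow>
        (\<And>k'. k' \<in> K \<Longrightarrow> p \<bullet> k' \<le> p \<bullet> k) \<Longrightarrow> F (x, t) (p, \<tau>) \<le> \<tau> + p \<bullet> k"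
    and k0: "k0 \<in> K" "x0 = X - (T - t0) *\<^sub>R k0"
    and base: "\<And>k. k \<in> K \<Longrightarrow> \<mu> \<le> w (X - (T - s) *\<^sub>R k, s)"
  shows "\<mu> \<le> w (x0, t0)"
proof (rule ccontr)
  assume "\<not> ?thesis"
  then have lt: "w (x0, t0) < \<mu>" by simp
  \<comment> \<open>A third of the gap: the competitor at \<open>(x0, t0)\<close> has value
    \<open>\<mu> - 2 * \<delta>\<close>, while every point near the base will have value above
    \<open>\<mu> - \<delta>\<close>.\<close>
  define \<delta> where "\<delta> = (\<mu> - w (x0, t0)) / 3"
  have \<delta>: "\<delta> > 0" "w (x0, t0) = \<mu> - 3 * \<delta>" using lt by (auto simp: \<delta>_def field_simps)
  \<comment> \<open>Here \<open>z\<close> is the displacement from the cone point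
    \<open>X - (T - t) *\<^sub>R k\<close>; in these coordinates the tube around the cone becomes
    the compact product \<open>Q\<close>.\<close>
  define \<Phi> where "\<Phi> = (\<lambda>(z :: 'a, t, k). (X - (T - t) *\<^sub>R k + z, t))"
  define Q where "Q = cball (0::'a) \<rho> \<times> {s..T} \<times> K"
  have compQ: "compact Q" unfolding Q_def using K by (intro compact_Times) auto
  have cont\<Phi>: "continuous_on Q \<Phi>"
    unfolding \<Phi>_def split_beta by (intro continuous_intros)
  have contW: "continuous_on Q (\<lambda>q. w (\<Phi> q))"
    using time by (intro continuous_on_compose2[OF cont cont\<Phi>]) (auto simp: \<Phi>_def Q_def)
  obtain B where B: "\<And>q. q \<in> Q \<Longrightarrow> \<bar>w (\<Phi> q)\<bar> \<le> B"
    using compact_imp_bounded[OF compact_continuous_image[OF contW compQ]]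
    by (auto simp: bounded_iff)
  have "uniformly_continuous_on Q (\<lambda>q. w (\<Phi> q))"
    by (rule compact_uniformly_continuous[OF contW compQ])
  then obtain r0 where r0: "r0 > 0" "\<And>p q. p \<in> Q \<Longrightarrow> q \<in> Q \<Longrightarrow> dist p q < r0 \<Longrightarrow> \<bar>w (\<Phi> p) - w (\<Phi> q)\<bar> < \<delta>"
    unfolding uniformly_continuous_on_def using \<open>\<delta> > 0\<close> by (metis dist_real_def)
  define r where "r = min r0 \<rho>"
  have r: "0 < r" "r \<le> r0" "r \<le> \<rho>" using r0(1) \<open>\<rho> > 0\<close> by (auto simp: r_def)
  \<comment> \<open>Large enough that a displacement of length \<open>r\<close> costs more than
    \<open>w\<close> can gain on \<open>Q\<close>, which keeps the minimiser off the lateral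
    boundary.\<close>
  define A where "A = (2 * B + 2 * \<delta>) / r\<^sup>2"
  have "(0, t0, k0) \<in> Q" using time k0 \<open>\<rho> > 0\<close> by (auto simp: Q_def)
  with B have "0 \<le> B" by fastforce
  then have A: "A > 0" "A * r\<^sup>2 = 2 * B + 2 * \<delta>" using r \<delta> by (auto simp: A_def)
  \<comment> \<open>Steep enough that the exponential term, equal to \<open>\<delta>\<close> at
    \<open>t0\<close>, exceeds \<open>2 * B + 2 * \<delta>\<close> at the apex time
    \<open>T\<close>, which keeps the minimiser off the top.\<close>
  define l where "l = (2 * B + 2 * \<delta>) / (\<delta> * (T - t0))"
  have l: "l > 0" "\<delta> * (l * (T - t0)) = 2 * B + 2 * \<delta>"
    using time \<delta> \<open>0 \<le> B\<close> by (auto simp: l_def)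
  have top: "\<delta> * exp (l * (T - t0)) > 2 * B + 2 * \<delta>"
  proof -
    have "\<delta> * (1 + l * (T - t0)) \<le> \<delta> * exp (l * (T - t0))"
      using \<delta> by (intro mult_left_mono exp_ge_add_one_self) auto
    then show ?thesis using l \<delta> by (simp add: distrib_left)
  qed
  define J where "J = (\<lambda>(z, t, k). w (\<Phi> (z, t, k)) + A * (norm z)\<^sup>2 + \<delta> * exp (l * (t - t0)))"
  have "continuous_on Q J"
    unfolding J_def split_beta using contW by (intro continuous_intros) (auto simp: split_beta)
  then obtain q where "q \<in> Q" and qmin: "\<And>p. p \<in> Q \<Longrightarrow> J q \<le> J p"
    using continuous_attains_inf[OF compQ] \<open>(0, t0, k0) \<in> Q\<close> by blast
  obtain z1 t1 k1 where q: "q = (z1, t1, k1)" by (cases q)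
  have in1: "norm z1 \<le> \<rho>" "s \<le> t1" "t1 \<le> T" "k1 \<in> K"
    using \<open>q \<in> Q\<close> by (auto simp: q Q_def)
  have J0: "J q \<le> \<mu> - 2 * \<delta>"
    using qmin[OF \<open>(0, t0, k0) \<in> Q\<close>] \<delta> k0 by (simp add: J_def \<Phi>_def)
  have "w (x0, t0) \<le> B"
    using B[OF \<open>(0, t0, k0) \<in> Q\<close>] k0 by (simp add: \<Phi>_def)
  then have J0': "J q \<le> B + \<delta>" using J0 \<delta> by simp
  have Jq: "J q = w (\<Phi> q) + A * (norm z1)\<^sup>2 + \<delta> * exp (l * (t1 - t0))"
    by (simp add: J_def q)
  have wq: "- B \<le> w (\<Phi> q)" using B[OF \<open>q \<in> Q\<close>] by simp
  have nz: "norm z1 < r"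
  proof (rule ccontr)
    assume "\<not> norm z1 < r"
    then have "A * r\<^sup>2 \<le> A * (norm z1)\<^sup>2"
      using A r by (intro mult_left_mono power_mono) auto
    moreover have "0 < \<delta> * exp (l * (t1 - t0))" using \<delta> by simp
    ultimately show False using Jq wq J0' A \<delta>(1) by linarith
  qed
  have "t1 \<noteq> T"
  proof
    assume "t1 = T"
    moreover have "0 \<le> A * (norm z1)\<^sup>2" using A by simp
    ultimately show False using Jq wq J0' top \<delta> by simp
  qed
  \<comment> \<open>At the base, replacing \<open>z1\<close> by 0 changes \<open>w\<close> by less
    than \<open>\<delta>\<close> and lands where \<open>\<mu> \<le> w\<close>, so the minimum would
    exceed \<open>\<mu> - \<delta>\<close>.\<close>
  have "t1 \<noteq> s"
  proof
    assume "t1 = s"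
    have "(0, s, k1) \<in> Q" using in1 time \<open>\<rho> > 0\<close> by (auto simp: Q_def)
    moreover have "dist q (0, s, k1) < r0"
      using nz r by (simp add: q \<open>t1 = s\<close> dist_Pair_Pair)
    ultimately have "\<bar>w (\<Phi> q) - w (\<Phi> (0, s, k1))\<bar> < \<delta>"
      using r0(2) \<open>q \<in> Q\<close> by blast
    moreover have "\<mu> \<le> w (\<Phi> (0, s, k1))" using base[OF in1(4)] by (simp add: \<Phi>_def)
    moreover have "0 \<le> A * (norm z1)\<^sup>2" "0 < \<delta> * exp (l * (t1 - t0))" using A \<delta> by auto
    ultimately show False using Jq J0 \<delta> by linarith
  qed
  have t1: "s < t1" "t1 < T" using \<open>t1 \<noteq> s\<close> \<open>t1 \<noteq> T\<close> in1 by auto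
  have "norm z1 < \<rho>" using nz r by simp
  define x1 where "x1 = X - (T - t1) *\<^sub>R k1 + z1"
  have z1: "z1 = x1 - X + (T - t1) *\<^sub>R k1" by (simp add: x1_def)
  \<comment> \<open>Moving \<open>k1\<close> slightly towards \<open>k\<close> and shifting
    \<open>z1\<close> by \<open>e *\<^sub>R v\<close> keeps the space-time point fixed. Only the
    quadratic term of \<open>J\<close> changes, and if the inner product could be lowered this term
    would decrease to first order.\<close>
  have opt: "z1 \<bullet> k1 \<le> z1 \<bullet> k" if "k \<in> K" for k
  proof (rule ccontr)
    assume "\<not> z1 \<bullet> k1 \<le> z1 \<bullet> k"
    define v where "v = (T - t1) *\<^sub>R (k - k1)"
    have neg: "z1 \<bullet> v < 0"
      using \<open>\<not> z1 \<bullet> k1 \<le> z1 \<bullet> k\<close> t1 by (simp add: v_def inner_diff_right mult_pos_neg)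
    have "((\<lambda>e. norm (z1 + e *\<^sub>R v)) \<longlongrightarrow> norm (z1 + 0 *\<^sub>R v)) (at_right 0)"
      by (intro tendsto_intros)
    then have "eventually (\<lambda>e. norm (z1 + e *\<^sub>R v) < \<rho>) (at_right 0)"
      using \<open>norm z1 < \<rho>\<close> by (intro order_tendstoD(2)) auto
    moreover have "((\<lambda>e. 2 * (z1 \<bullet> v) + e * (v \<bullet> v)) \<longlongrightarrow> 2 * (z1 \<bullet> v) + 0 * (v \<bullet> v)) (at_right 0)"
      by (intro tendsto_intros)
    then have "eventually (\<lambda>e. 2 * (z1 \<bullet> v) + e * (v \<bullet> v) < 0) (at_right 0)"
      by (rule order_tendstoD(2)) (use neg in simp)
    moreover have "eventually (\<lambda>e::real. 0 < e \<and> e < 1) (at_right 0)"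
      using eventually_at_right_real[of 0 1] by (auto elim: eventually_mono)
    ultimately have "eventually (\<lambda>e. norm (z1 + e *\<^sub>R v) < \<rho> \<and> 2 * (z1 \<bullet> v) + e * (v \<bullet> v) < 0
        \<and> 0 < e \<and> e < 1) (at_right 0)"
      by eventually_elim auto
    then obtain e where e: "norm (z1 + e *\<^sub>R v) < \<rho>" "2 * (z1 \<bullet> v) + e * (v \<bullet> v) < 0" "0 < e" "e < 1"
      using eventually_happens'[OF trivial_limit_at_right_real] by fastforce
    define k' where "k' = k1 + e *\<^sub>R (k - k1)"
    have "k' = (1 - e) *\<^sub>R k1 + e *\<^sub>R k" by (simp add: k'_def algebra_simps)
    then have "k' \<in> K" using convexD_alt[OF K(2) in1(4) that, of e] e by simp
    have zev: "z1 + e *\<^sub>R v = x1 - X + (T - t1) *\<^sub>R k'"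
      by (simp add: z1 v_def k'_def algebra_simps)
    have mem: "(z1 + e *\<^sub>R v, t1, k') \<in> Q"
      using e in1 \<open>k' \<in> K\<close> by (simp add: Q_def)
    have "\<Phi> (z1 + e *\<^sub>R v, t1, k') = \<Phi> q"
      by (simp add: \<Phi>_def zev q) (simp add: z1)
    then have "A * (norm z1)\<^sup>2 \<le> A * (norm (z1 + e *\<^sub>R v))\<^sup>2"
      using qmin[OF mem] Jq by (simp add: J_def)
    then have "(norm z1)\<^sup>2 \<le> (norm (z1 + e *\<^sub>R v))\<^sup>2" using A by simp
    also have "\<dots> = (norm z1)\<^sup>2 + e * (2 * (z1 \<bullet> v) + e * (v \<bullet> v))"
      unfolding power2_norm_eq_inner by (simp add: algebra_simps inner_commute)
    finally show False using mult_pos_neg[OF e(3,2)] by simp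
  qed
  define \<phi> where "\<phi> = (\<lambda>(x, t). - A * (norm (x - X + (T - t) *\<^sub>R k1))\<^sup>2 - \<delta> * exp (l * (t - t0)))"
  define G where "G = (\<lambda>(x, t). (- 2 * A) *\<^sub>R (x - X + (T - t) *\<^sub>R k1, - ((x - X + (T - t) *\<^sub>R k1) \<bullet> k1))
    - (0, \<delta> * l * exp (l * (t - t0))))"
  have C1: "C1_with_gradient (UNIV \<times> {0<..}) \<phi> G"
    unfolding C1_with_gradient_def
  proof
    show "\<forall>z\<in>UNIV \<times> {0<..}. GDERIV \<phi> z :> G z"
      unfolding \<phi>_def G_def using GDERIV_cone_test[of A X T k1 \<delta> l t0] by auto
    show "continuous_on (UNIV \<times> {0<..}) G"
      unfolding G_def split_beta by (intro continuous_intros)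
  qed
  have "local_max_at (UNIV \<times> {0<..}) (\<lambda>y. \<phi> y - w y) (x1, t1)"
  proof -
    define V where "V = {y :: 'a \<times> real. norm (fst y - X + (T - snd y) *\<^sub>R k1) < \<rho> \<and> s < snd y \<and> snd y < T}"
    have "open V"
      unfolding V_def by (intro open_Collect_conj open_Collect_less continuous_intros)
    moreover have "(x1, t1) \<in> V" using \<open>norm z1 < \<rho>\<close> t1 by (simp add: V_def z1[symmetric])
    ultimately obtain d where d: "d > 0" "ball (x1, t1) d \<subseteq> V"
      using openE by blast
    have "\<phi> y - w y \<le> \<phi> (x1, t1) - w (x1, t1)" if "y \<in> V" for y
    proof -
      obtain x t where y: "y = (x, t)" by (cases y)
      have "(x - X + (T - t) *\<^sub>R k1, t, k1) \<in> Q"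
        using that in1 by (auto simp: V_def y Q_def)
      from qmin[OF this] show ?thesis
        by (simp add: Jq y \<phi>_def z1[symmetric]) (simp add: J_def \<Phi>_def q x1_def)
    qed
    with d show ?thesis unfolding local_max_at_def by (intro exI[of _ d]) auto
  qed
  with C1 super have ge: "F (x1, t1) (G (x1, t1)) \<ge> 0"
    unfolding viscosity_supersolution_def using t1 time by auto
  have G1: "G (x1, t1) = ((- 2 * A) *\<^sub>R z1, 2 * A * (z1 \<bullet> k1) - \<delta> * l * exp (l * (t1 - t0)))"
    by (simp add: G_def z1[symmetric])
  \<comment> \<open>The spatial gradient is a negative multiple of \<open>z1\<close>, so
    \<open>opt\<close> makes \<open>k1\<close> a maximiser, as hypothesis \<open>F\<close> demands.
    The terms with \<open>z1 \<bullet> k1\<close> then cancel and only the negative exponential term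
    is left.\<close>
  have "F (x1, t1) (G (x1, t1)) \<le> (2 * A * (z1 \<bullet> k1) - \<delta> * l * exp (l * (t1 - t0))) + ((- 2 * A) *\<^sub>R z1) \<bullet> k1"
    unfolding G1
  proof (rule F[OF t1 in1(4)])
    show "norm (x1 - X + (T - t1) *\<^sub>R k1) < \<rho>" using \<open>norm z1 < \<rho>\<close> z1 by simp
    show "((- 2 * A) *\<^sub>R z1) \<bullet> k \<le> ((- 2 * A) *\<^sub>R z1) \<bullet> k1" if "k \<in> K" for k
      using opt[OF that] A by simp
  qed
  also have "\<dots> = - (\<delta> * l * exp (l * (t1 - t0)))" by simp
  also have "\<dots> < 0" using \<delta> l by simp
  finally show False using ge by simp
qed

text \<open>By reflection \<open>- w\<close> is a supersolution, and the cone over the single point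
  \<open>k\<close> is a line, for which the maximality condition of the cone comparison is vacuous.
  The apex is placed on the extended line at time \<open>T\<close>, after \<open>t0\<close>.\<close>

lemma subsolution_line:
  fixes w :: "'a::euclidean_space \<times> real \<Rightarrow> real"
  assumes cont: "continuous_on (UNIV \<times> {0..}) w"
    and sub: "viscosity_subsolution F (UNIV \<times> {0<..}) w"
    and time: "0 \<le> s" "s < t0" and "\<rho> > 0"
    and F: "\<And>x t p \<tau>. s < t \<Longrightarrow> t < T \<Longrightarrow> norm (x - x0 + (t0 - t) *\<^sub>R k) < \<rho> \<Longrightarrow>
        \<tau> + p \<bullet> k \<le> F (x, t) (p, \<tau>)"
    and T: "t0 < T"
  shows "w (x0, t0) \<le> w (x0 - (t0 - s) *\<^sub>R k, s)"
proof -
  have "- w (x0 - (t0 - s) *\<^sub>R k, s) \<le> - w (x0, t0)"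
  proof (rule supersolution_cone[where K="{k}" and F="\<lambda>z P. - F z (- P)" and X="x0 + (T - t0) *\<^sub>R k"
        and T=T and w="\<lambda>z. - w z" and \<rho>=\<rho> and s=s and ?k0.0=k])
    show "viscosity_supersolution (\<lambda>z P. - F z (- P)) (UNIV \<times> {0<..}) (\<lambda>z. - w z)"
      unfolding viscosity_supersolution_def
    proof (intro allI impI)
      fix \<phi> :: "'a \<times> real \<Rightarrow> real" and G z
      assume C1: "C1_with_gradient (UNIV \<times> {0<..}) \<phi> G" and z: "z \<in> UNIV \<times> {0<..}"
        and max: "local_max_at (UNIV \<times> {0<..}) (\<lambda>y. \<phi> y - - w y) z"
      have "C1_with_gradient (UNIV \<times> {0<..}) (\<lambda>y. - \<phi> y) (\<lambda>y. - G y)"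
        using C1 unfolding C1_with_gradient_def by (auto intro: GDERIV_minus continuous_on_minus)
      moreover have "local_max_at (UNIV \<times> {0<..}) (\<lambda>y. w y - - \<phi> y) z"
        using max by (simp add: add.commute)
      ultimately have "F z (- G z) \<le> 0"
        using sub z unfolding viscosity_subsolution_def by blast
      then show "0 \<le> - F z (- G z)" by simp
    qed
    fix x t k' p \<tau>
    assume "s < t" "t < T" "k' \<in> {k}" "norm (x - (x0 + (T - t0) *\<^sub>R k) + (T - t) *\<^sub>R k') < \<rho>"
    then show "- F (x, t) (- (p, \<tau>)) \<le> \<tau> + p \<bullet> k'"
      using F[of t x "- \<tau>" "- p"] by (simp add: algebra_simps)
  qed (use time T \<open>\<rho> > 0\<close> cont in \<open>auto simp: algebra_simps intro: continuous_on_minus\<close>)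
  then show ?thesis by simp
qed

text \<open>The slack \<open>1 + \<eta>\<close> absorbs the oscillation of \<open>b\<close> along one step of a polygonal path.\<close>

definition relatively_uniform :: "('a::metric_space \<Rightarrow> real) \<Rightarrow> bool" where
  "relatively_uniform b \<longleftrightarrow> (\<forall>\<eta>>0. \<exists>\<rho>>0. \<forall>x y. dist x y \<le> \<rho> \<longrightarrow> b x \<le> (1 + \<eta>) * b y)"

section \<open>Short time steps for the equation with speed \<open>b\<close>\<close>

lemma split_into_small_steps:
  assumes "0 < t" "0 < (e :: real)"
  obtains h and n :: nat where "0 < h" "h \<le> e" "t = real n * h"
proof -
  obtain n :: nat where n: "t / e < real n" using reals_Archimedean2 by blast
  then have "0 < real n" using assms by (meson divide_pos_pos less_trans)
  then show ?thesis
    using n assms by (intro that[of "t / real n" n]) (auto simp: field_simps)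
qed

context
  fixes b :: "'a::euclidean_space \<Rightarrow> real" and M :: real and w :: "'a \<times> real \<Rightarrow> real"
  assumes pos: "\<And>x. 0 < b x" and M: "\<And>x. b x \<le> M" and unif: "relatively_uniform b"
    and cont: "continuous_on (UNIV \<times> {0..}) w"
begin

lemma speed_bound_pos: "0 < M"
  using pos M less_le_trans by blast

text \<open>The path covers a distance of at most \<open>(1 + \<eta>) * b x * h\<close>. A straight
  line from \<open>x\<close> to \<open>z\<close> traversed in the longer time
  \<open>(1 + \<eta>)\<^sup>2 * h\<close> has speed at most \<open>b x / (1 + \<eta>)\<close>, which
  is at most \<open>b\<close> everywhere within \<open>\<rho>\<close> of \<open>x\<close>, so the
  line comparison applies.\<close>

lemma subsolution_le_step:
  assumes sub: "viscosity_subsolution (\<lambda>(x, t) (p, \<tau>). \<tau> + b x * norm p) (UNIV \<times> {0<..}) w"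
    and \<eta>: "\<eta> > 0" and \<rho>: "\<rho> > 0" "\<And>x y. dist x y \<le> \<rho> \<Longrightarrow> b x \<le> (1 + \<eta>) * b y"
    and h: "0 < h" "M * h \<le> \<rho> / 2" and z: "z \<in> reachable b h x" and "0 \<le> \<sigma>"
  shows "w (x, \<sigma> + (1 + \<eta>)\<^sup>2 * h) \<le> w (z, \<sigma>)"
proof -
  define H where "H = (1 + \<eta>)\<^sup>2 * h"
  have H: "H > 0" using h \<eta> by (simp add: H_def)
  define k where "k = (1 / H) *\<^sub>R (x - z)"
  have Hk: "H *\<^sub>R k = x - z" using H by (simp add: k_def)
  have "norm (z - x) \<le> ((1 + \<eta>) * b x) * h"
    using z h(1) M
  proof (intro reachable_norm_le_local[of z b h x M])
    fix y assume "norm (y - x) \<le> M * h"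
    then show "b y \<le> (1 + \<eta>) * b x" using h \<rho> by (intro \<rho>(2)) (auto simp: dist_norm)
  qed auto
  also have "\<dots> = H * (b x / (1 + \<eta>))" using \<eta> by (simp add: H_def power2_eq_square)
  finally have "H * norm k \<le> H * (b x / (1 + \<eta>))"
    using arg_cong[OF Hk, of norm] H by (simp add: norm_minus_commute)
  then have k: "norm k \<le> b x / (1 + \<eta>)" using H by (simp only: mult_le_cancel_left_pos)
  have zx: "norm (z - x) \<le> \<rho> / 2" using reachable_norm_le[OF z _ M] h by simp
  \<comment> \<open>Half of \<open>\<rho>\<close> is spent on the tube and half on the line. For
    times up to \<open>\<sigma> + H + H\<close> the distance travelled from \<open>x\<close> along
    the line is still at most \<open>H * norm k\<close>.\<close>
  have "w (x, \<sigma> + H) \<le> w (x - (\<sigma> + H - \<sigma>) *\<^sub>R k, \<sigma>)"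
  proof (rule subsolution_line[OF cont sub, where T="\<sigma> + H + H" and \<rho>="\<rho> / 2"])
    fix x' t p \<tau>
    assume t: "\<sigma> < t" "t < \<sigma> + H + H" and n: "norm (x' - x + (\<sigma> + H - t) *\<^sub>R k) < \<rho> / 2"
    have "norm (x' - x) \<le> norm (x' - x + (\<sigma> + H - t) *\<^sub>R k) + norm ((\<sigma> + H - t) *\<^sub>R k)"
      using norm_triangle_ineq4[of "x' - x + (\<sigma> + H - t) *\<^sub>R k" "(\<sigma> + H - t) *\<^sub>R k"] by simp
    also have "norm ((\<sigma> + H - t) *\<^sub>R k) \<le> H * norm k"
      using t by (simp add: mult_right_mono)
    also have "H * norm k = norm (z - x)"
      using arg_cong[OF Hk, of norm] H by (simp add: norm_minus_commute)
    finally have "dist x x' \<le> \<rho>" using n zx by (simp add: dist_norm norm_minus_commute)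
    then have "b x \<le> (1 + \<eta>) * b x'" by (rule \<rho>(2))
    then have "b x / (1 + \<eta>) \<le> b x'" using \<eta> by (simp add: field_simps)
    then have "p \<bullet> k \<le> norm p * b x'"
      using k norm_cauchy_schwarz[of p k] by (meson mult_left_mono norm_ge_zero order_trans)
    then show "\<tau> + p \<bullet> k \<le> (case (x', t) of (x, t) \<Rightarrow> \<lambda>(p, \<tau>). \<tau> + b x * norm p) (p, \<tau>)"
      by (simp add: mult.commute)
  qed (use H \<open>0 \<le> \<sigma>\<close> \<rho>(1) in auto)
  then show ?thesis using Hk by (simp add: H_def)
qed

lemma subsolution_le_chain:
  assumes sub: "viscosity_subsolution (\<lambda>(x, t) (p, \<tau>). \<tau> + b x * norm p) (UNIV \<times> {0<..}) w"
    and \<eta>: "\<eta> > 0" and \<rho>: "\<rho> > 0" "\<And>x y. dist x y \<le> \<rho> \<Longrightarrow> b x \<le> (1 + \<eta>) * b y"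
    and h: "0 < h" "M * h \<le> \<rho> / 2" and z: "z \<in> reachable b (real n * h) x"
  shows "w (x, (1 + \<eta>)\<^sup>2 * (real n * h)) \<le> w (z, 0)"
  using z
proof (induction n arbitrary: x)
  case 0
  then show ?case by (auto simp: reachable_def)
next
  case (Suc n)
  have "real (Suc n) * h = h + real n * h" by (simp add: algebra_simps)
  then obtain y where y: "y \<in> reachable b h x" "z \<in> reachable b (real n * h) y"
    using reachable_split[of z b h "real n * h" x] Suc.prems h by auto
  have "w (x, (1 + \<eta>)\<^sup>2 * (real n * h) + (1 + \<eta>)\<^sup>2 * h) \<le> w (y, (1 + \<eta>)\<^sup>2 * (real n * h))"
    using h \<eta> by (intro subsolution_le_step[OF sub \<eta> \<rho> h y(1)]) auto
  also have "\<dots> \<le> w (z, 0)" by (rule Suc.IH[OF y(2)])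
  finally show ?case by (simp add: algebra_simps)
qed

text \<open>The step size depends on \<open>\<eta>\<close> but the end point \<open>z\<close> does
  not, so letting \<open>\<eta>\<close> tend to 0 removes the slack by continuity of
  \<open>w\<close> in time.\<close>

lemma subsolution_le_reachable:
  assumes sub: "viscosity_subsolution (\<lambda>(x, t) (p, \<tau>). \<tau> + b x * norm p) (UNIV \<times> {0<..}) w"
    and z: "z \<in> reachable b t x" and "0 < t"
  shows "w (x, t) \<le> w (z, 0)"
proof -
  have *: "w (x, (1 + \<eta>)\<^sup>2 * t) \<le> w (z, 0)" if \<eta>: "\<eta> > 0" for \<eta>
  proof -
    obtain \<rho> where \<rho>: "\<rho> > 0" "\<And>x y. dist x y \<le> \<rho> \<Longrightarrow> b x \<le> (1 + \<eta>) * b y"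
      using unif[unfolded relatively_uniform_def, rule_format, OF \<eta>] by auto
    have "0 < \<rho> / 2 / M" using \<rho>(1) speed_bound_pos by simp
    then obtain h n where h: "0 < h" "h \<le> \<rho> / 2 / M" "t = real n * h"
      using split_into_small_steps[OF \<open>0 < t\<close>] by blast
    then have "M * h \<le> \<rho> / 2" using speed_bound_pos by (simp add: field_simps)
    then show ?thesis
      using subsolution_le_chain[OF sub \<eta> \<rho> h(1), of z n x] z unfolding h(3) by blast
  qed
  have "((\<lambda>\<eta>. w (x, (1 + \<eta>)\<^sup>2 * t)) \<longlongrightarrow> w (x, (1 + 0)\<^sup>2 * t)) (at_right 0)"
    by (rule continuous_on_tendsto_compose[OF cont]; (intro tendsto_intros)?) (use \<open>0 < t\<close> in auto)
  moreover have "eventually (\<lambda>\<eta>. w (x, (1 + \<eta>)\<^sup>2 * t) \<le> w (z, 0)) (at_right 0)"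
    by (rule eventually_mono[OF eventually_at_right_less[of 0] *])
  ultimately show ?thesis using tendsto_upperbound[of _ _ "at_right (0::real)"] by fastforce
qed

text \<open>Near \<open>x\<close> the speed is at most \<open>M' = (1 + \<eta>) * b x\<close>, so
  the cone comparison holds with the ball of radius \<open>M'\<close>. Its base minimiser is at
  distance at most \<open>H * M'\<close> from \<open>x\<close>; as \<open>b\<close> is at least
  \<open>b x / (1 + \<eta>)\<close> on the way, the straight segment reaches it in time
  \<open>(1 + \<eta>) ^ 3 * h\<close>.\<close>

lemma supersolution_ge_step:
  assumes super: "viscosity_supersolution (\<lambda>(x, t) (p, \<tau>). \<tau> + b x * norm p) (UNIV \<times> {0<..}) w"
    and \<eta>: "\<eta> > 0" and \<rho>: "\<rho> > 0" "\<And>x y. dist x y \<le> \<rho> \<Longrightarrow> b x \<le> (1 + \<eta>) * b y"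
    and h: "0 < h" "(1 + \<eta>)\<^sup>2 * M * h \<le> \<rho> / 2" and "0 \<le> \<sigma>"
  shows "\<exists>y\<in>reachable b ((1 + \<eta>) ^ 3 * h) x. w (y, \<sigma>) \<le> w (x, \<sigma> + h)"
proof -
  define M' where "M' = (1 + \<eta>) * b x"
  have "M' > 0" using pos \<eta> by (simp add: M'_def)
  \<comment> \<open>The cone is made higher than \<open>h\<close> because the comparison point must
    lie strictly before the apex.\<close>
  define H where "H = (1 + \<eta>) * h"
  have H: "0 < H" "h < H" using h \<eta> by (auto simp: H_def)
  have "H * M' = (1 + \<eta>)\<^sup>2 * b x * h" by (simp add: H_def M'_def power2_eq_square)
  also have "\<dots> \<le> (1 + \<eta>)\<^sup>2 * M * h" using M h by (intro mult_right_mono mult_left_mono) auto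
  finally have HM: "H * M' \<le> \<rho> / 2" using h by simp
  have "continuous_on (cball 0 M') (\<lambda>k. w (x - H *\<^sub>R k, \<sigma>))"
    using \<open>0 \<le> \<sigma>\<close> by (intro continuous_on_compose2[OF cont] continuous_intros) auto
  then obtain k0 where k0: "k0 \<in> cball 0 M'"
    and min: "\<And>k. k \<in> cball 0 M' \<Longrightarrow> w (x - H *\<^sub>R k0, \<sigma>) \<le> w (x - H *\<^sub>R k, \<sigma>)"
    using continuous_attains_inf[of "cball 0 M'" "\<lambda>k. w (x - H *\<^sub>R k, \<sigma>)"] \<open>M' > 0\<close> by auto
  have "w (x - H *\<^sub>R k0, \<sigma>) \<le> w (x, \<sigma> + h)"
  proof (rule supersolution_cone[OF compact_cball convex_cball cont super, where s=\<sigma> and T="\<sigma> + H"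
        and \<rho>="\<rho> / 2" and X=x and ?k0.0=0])
    fix k :: 'a assume "k \<in> cball 0 M'"
    then show "w (x - H *\<^sub>R k0, \<sigma>) \<le> w (x - (\<sigma> + H - \<sigma>) *\<^sub>R k, \<sigma>)" using min by simp
  next
    fix x' k p :: 'a and t \<tau>
    assume t: "\<sigma> < t" "t < \<sigma> + H" and k: "k \<in> cball 0 M'"
      and n: "norm (x' - x + (\<sigma> + H - t) *\<^sub>R k) < \<rho> / 2"
      and max: "\<And>k'. k' \<in> cball 0 M' \<Longrightarrow> p \<bullet> k' \<le> p \<bullet> k"
    have "norm (x' - x) \<le> norm (x' - x + (\<sigma> + H - t) *\<^sub>R k) + norm ((\<sigma> + H - t) *\<^sub>R k)"
      using norm_triangle_ineq4[of "x' - x + (\<sigma> + H - t) *\<^sub>R k" "(\<sigma> + H - t) *\<^sub>R k"] by simp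
    also have "norm ((\<sigma> + H - t) *\<^sub>R k) \<le> H * M'"
      using t k H by (auto intro!: mult_mono)
    finally have "dist x' x \<le> \<rho>" using n HM by (simp add: dist_norm)
    then have "b x' \<le> M'" unfolding M'_def by (rule \<rho>(2))
    then have "b x' * norm p \<le> M' * norm p" by (simp add: mult_right_mono)
    \<comment> \<open>The vector of length at most \<open>M'\<close> along \<open>p\<close> attains
      \<open>M' * norm p\<close>, and the maximiser \<open>k\<close> does at least as well.\<close>
    also have "\<dots> = p \<bullet> (M' *\<^sub>R sgn p)"
      by (cases "p = 0") (simp_all add: sgn_div_norm power2_norm_eq_inner[symmetric] power2_eq_square)
    also have "\<dots> \<le> p \<bullet> k"
      using \<open>M' > 0\<close> by (intro max) (simp add: norm_sgn)
    finally show "(case (x', t) of (x, t) \<Rightarrow> \<lambda>(p, \<tau>). \<tau> + b x * norm p) (p, \<tau>) \<le> \<tau> + p \<bullet> k"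
      by simp
  qed (use H h(1) \<open>0 \<le> \<sigma>\<close> \<rho>(1) \<open>M' > 0\<close> in auto)
  moreover have "x - H *\<^sub>R k0 \<in> reachable b ((1 + \<eta>) ^ 3 * h) x"
  proof (rule reachable_segment)
    have n: "norm (x - H *\<^sub>R k0 - x) \<le> H * M'"
      using k0 H by simp
    also have "\<dots> = b x / (1 + \<eta>) * ((1 + \<eta>) ^ 3 * h)"
      using \<eta> by (simp add: H_def M'_def power3_eq_cube)
    finally show "norm (x - H *\<^sub>R k0 - x) \<le> b x / (1 + \<eta>) * ((1 + \<eta>) ^ 3 * h)" .
    show "0 \<le> (1 + \<eta>) ^ 3 * h" using \<eta> h by simp
    fix z assume "z \<in> closed_segment x (x - H *\<^sub>R k0)"
    then have "dist x z \<le> norm (x - H *\<^sub>R k0 - x)"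
      using dist_in_closed_segment[of z x "x - H *\<^sub>R k0"] by (simp add: dist_norm norm_minus_commute)
    also have "\<dots> \<le> \<rho>" using n HM \<rho>(1) by linarith
    finally have "b x \<le> (1 + \<eta>) * b z" by (rule \<rho>(2))
    then show "b x / (1 + \<eta>) \<le> b z"
      using \<eta> by (simp add: field_simps)
  qed
  ultimately show ?thesis by blast
qed

lemma supersolution_ge_chain:
  assumes super: "viscosity_supersolution (\<lambda>(x, t) (p, \<tau>). \<tau> + b x * norm p) (UNIV \<times> {0<..}) w"
    and \<eta>: "\<eta> > 0" and \<rho>: "\<rho> > 0" "\<And>x y. dist x y \<le> \<rho> \<Longrightarrow> b x \<le> (1 + \<eta>) * b y"
    and h: "0 < h" "(1 + \<eta>)\<^sup>2 * M * h \<le> \<rho> / 2"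
  shows "\<exists>y\<in>reachable b ((1 + \<eta>) ^ 3 * (real n * h)) x. w (y, 0) \<le> w (x, real n * h)"
proof (induction n arbitrary: x)
  case 0
  then show ?case using reachable_refl[of 0 b x] pos less_imp_le by auto
next
  case (Suc n)
  obtain z where z: "z \<in> reachable b ((1 + \<eta>) ^ 3 * h) x" "w (z, real n * h) \<le> w (x, real n * h + h)"
    using supersolution_ge_step[OF super \<eta> \<rho> h, of "real n * h" x] h by auto
  obtain y where y: "y \<in> reachable b ((1 + \<eta>) ^ 3 * (real n * h)) z" "w (y, 0) \<le> w (z, real n * h)"
    using Suc.IH by blast
  have "y \<in> reachable b ((1 + \<eta>) ^ 3 * h + (1 + \<eta>) ^ 3 * (real n * h)) x"
    using \<eta> h by (intro reachable_trans[OF z(1) y(1)]) auto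
  then show ?case using z y by (intro bexI[of _ y]) (auto simp: algebra_simps)
qed

text \<open>The end point depends on \<open>\<eta>\<close>, so the slack stays in the statement; it
  is removed only after reachable points have been compared with the limit shape.\<close>

lemma supersolution_ge_reachable:
  assumes super: "viscosity_supersolution (\<lambda>(x, t) (p, \<tau>). \<tau> + b x * norm p) (UNIV \<times> {0<..}) w"
    and "0 < t" "0 < \<eta>"
  shows "\<exists>y\<in>reachable b ((1 + \<eta>) ^ 3 * t) x. w (y, 0) \<le> w (x, t)"
proof -
  obtain \<rho> where \<rho>: "\<rho> > 0" "\<And>x y. dist x y \<le> \<rho> \<Longrightarrow> b x \<le> (1 + \<eta>) * b y"
    using unif[unfolded relatively_uniform_def, rule_format, OF \<open>0 < \<eta>\<close>] by auto
  have MM: "(1 + \<eta>)\<^sup>2 * M > 0" using speed_bound_pos assms by simp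
  then have "0 < \<rho> / 2 / ((1 + \<eta>)\<^sup>2 * M)" using \<rho>(1) by simp
  then obtain h n where h: "0 < h" "h \<le> \<rho> / 2 / ((1 + \<eta>)\<^sup>2 * M)" "t = real n * h"
    using split_into_small_steps[OF \<open>0 < t\<close>] by blast
  then have "(1 + \<eta>)\<^sup>2 * M * h \<le> \<rho> / 2"
    by (simp only: pos_le_divide_eq[OF MM] mult.commute[of h])
  then show ?thesis
    unfolding h(3) by (intro supersolution_ge_chain[OF super assms(3) \<rho> h(1)])
qed

end

section \<open>Hopf-Lax bounds for the limit equation\<close>

lemma support_function_ge:
  assumes "compact K" "k \<in> K"
  shows "p \<bullet> k \<le> support_function K p"
proof -
  have "compact ((\<lambda>q. p \<bullet> q) ` K)"
    by (intro compact_continuous_image continuous_intros assms)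
  then have "bdd_above ((\<lambda>q. p \<bullet> q) ` K)"
    by (intro bounded_imp_bdd_above compact_imp_bounded)
  then show ?thesis unfolding support_function_def using assms by (intro cSUP_upper)
qed

lemma Hopf_Lax_le:
  fixes w :: "'a::euclidean_space \<times> real \<Rightarrow> real"
  assumes "compact K" "q \<in> K" and cont: "continuous_on (UNIV \<times> {0..}) w"
    and sub: "viscosity_subsolution (\<lambda>(x, t) (p, \<tau>). \<tau> + support_function K p) (UNIV \<times> {0<..}) w"
    and "0 < t"
  shows "w (x, t) \<le> w (x - t *\<^sub>R q, 0)"
  using subsolution_line[OF cont sub, of 0 t 1 "t + 1" x q] support_function_ge[OF assms(1,2)] \<open>0 < t\<close>
  by simp

text \<open>One cone over \<open>K\<close> suffices, since the equation does not depend on the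
  position. Its apex lies above \<open>x\<close> at the later time \<open>(1 + \<eta>) * t\<close>,
  and \<open>0 \<in> K\<close> puts \<open>(x, t)\<close> inside the cone.\<close>

lemma Hopf_Lax_ge:
  fixes w :: "'a::euclidean_space \<times> real \<Rightarrow> real"
  assumes K: "compact K" "convex K" "0 \<in> K" and cont: "continuous_on (UNIV \<times> {0..}) w"
    and super: "viscosity_supersolution (\<lambda>(x, t) (p, \<tau>). \<tau> + support_function K p) (UNIV \<times> {0<..}) w"
    and "0 < t" "0 < \<eta>"
  shows "\<exists>q\<in>K. w (x - ((1 + \<eta>) * t) *\<^sub>R q, 0) \<le> w (x, t)"
proof -
  have "continuous_on K (\<lambda>k. w (x - ((1 + \<eta>) * t) *\<^sub>R k, 0))"
    by (intro continuous_on_compose2[OF cont] continuous_intros) auto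
  then obtain q where q: "q \<in> K"
    and min: "\<And>k. k \<in> K \<Longrightarrow> w (x - ((1 + \<eta>) * t) *\<^sub>R q, 0) \<le> w (x - ((1 + \<eta>) * t) *\<^sub>R k, 0)"
    using continuous_attains_inf[of K "\<lambda>k. w (x - ((1 + \<eta>) * t) *\<^sub>R k, 0)"] K by auto
  have "w (x - ((1 + \<eta>) * t) *\<^sub>R q, 0) \<le> w (x, t)"
  proof (rule supersolution_cone[OF K(1,2) cont super, where s=0 and T="(1 + \<eta>) * t"
        and \<rho>=1 and X=x and ?k0.0=0])
    fix x' t k p \<tau>
    assume "k \<in> K" and "\<And>k'. k' \<in> K \<Longrightarrow> p \<bullet> k' \<le> p \<bullet> k"
    then have "support_function K p \<le> p \<bullet> k"
      unfolding support_function_def by (intro cSUP_least) auto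
    then show "(case (x', t) of (x, t) \<Rightarrow> \<lambda>(p, \<tau>). \<tau> + support_function K p) (p, \<tau>) \<le> \<tau> + p \<bullet> k"
      by simp
  qed (use min K assms in auto)
  with q show ?thesis by blast
qed

section \<open>Reachable sets and the limit shape\<close>

text \<open>A vertex is exposed by some \<open>p\<close>, so \<open>p \<bullet> (v - u)\<close> is
  positive at all other generators \<open>u\<close>. Finitely many ratios have a common bound
  \<open>K\<close>, and the resulting condition on \<open>q\<close> is convex, hence passes to the
  hull. Losing little in direction \<open>p\<close> therefore means being close to
  \<open>v\<close>.\<close>

lemma extreme_point_of_polytope_linear_bound:
  fixes P :: "'a::euclidean_space set"
  assumes "polytope P" "v extreme_point_of P"
  shows "\<exists>p K. 0 \<le> K \<and> (\<forall>q\<in>P. norm (v - q) \<le> K * (p \<bullet> (v - q)))"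
proof -
  obtain V where V: "finite V" "P = convex hull V"
    using assms(1) unfolding polytope_def by blast
  have "{v} exposed_face_of P"
    using assms by (simp add: exposed_face_of_polyhedron polytope_imp_polyhedron face_of_singleton)
  then obtain p b where p: "P \<subseteq> {x. p \<bullet> x \<le> b}" "{v} = P \<inter> {x. p \<bullet> x = b}"
    unfolding exposed_face_of_def by blast
  have v: "v \<in> P" "p \<bullet> v = b" using p(2) by auto
  have pos: "0 < p \<bullet> (v - u)" if "u \<in> P" "u \<noteq> v" for u
  proof -
    have "p \<bullet> u \<le> b" "p \<bullet> u \<noteq> b" using that p by blast+
    then show ?thesis using v by (simp add: inner_diff_right)
  qed
  \<comment> \<open>The sum bounds every single ratio and is 0 when \<open>v\<close> is the only
    generator.\<close>
  define K where "K = (\<Sum>u\<in>V - {v}. norm (v - u) / (p \<bullet> (v - u)))"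
  have VP: "u \<in> P" if "u \<in> V" for u unfolding V(2) using that by (rule hull_inc)
  have nonneg: "0 \<le> norm (v - u) / (p \<bullet> (v - u))" if "u \<in> V - {v}" for u
    using pos[of u] VP[of u] that by auto
  have "K \<ge> 0" unfolding K_def by (intro sum_nonneg nonneg)
  have "convex {q. norm (v - q) \<le> K * (p \<bullet> (v - q))}"
  proof (rule convexI)
    fix x y and s r :: real
    assume x: "x \<in> {q. norm (v - q) \<le> K * (p \<bullet> (v - q))}" and y: "y \<in> {q. norm (v - q) \<le> K * (p \<bullet> (v - q))}"
      and sr: "0 \<le> s" "0 \<le> r" "s + r = 1"
    have eq: "v - (s *\<^sub>R x + r *\<^sub>R y) = s *\<^sub>R (v - x) + r *\<^sub>R (v - y)"
    proof -
      have "r = 1 - s" using sr(3) by simp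
      show ?thesis unfolding \<open>r = 1 - s\<close> by (simp add: algebra_simps)
    qed
    have "norm (s *\<^sub>R (v - x) + r *\<^sub>R (v - y)) \<le> s * norm (v - x) + r * norm (v - y)"
      using norm_triangle_ineq[of "s *\<^sub>R (v - x)" "r *\<^sub>R (v - y)"] sr by simp
    also have "\<dots> \<le> s * (K * (p \<bullet> (v - x))) + r * (K * (p \<bullet> (v - y)))"
      using x y sr by (intro add_mono mult_left_mono) auto
    also have "\<dots> = K * (p \<bullet> (s *\<^sub>R (v - x) + r *\<^sub>R (v - y)))"
      by (simp add: inner_add_right algebra_simps)
    finally show "s *\<^sub>R x + r *\<^sub>R y \<in> {q. norm (v - q) \<le> K * (p \<bullet> (v - q))}"
      by (simp only: mem_Collect_eq eq)
  qed
  moreover have "u \<in> {q. norm (v - q) \<le> K * (p \<bullet> (v - q))}" if "u \<in> V" for u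
  proof (cases "u = v")
    case False
    have "norm (v - u) / (p \<bullet> (v - u)) \<le> K"
      unfolding K_def using that False V by (intro member_le_sum nonneg) auto
    then show ?thesis using pos[OF VP[OF that] False] by (simp add: divide_le_eq)
  qed simp
  ultimately have "P \<subseteq> {q. norm (v - q) \<le> K * (p \<bullet> (v - q))}"
    unfolding V(2) by (intro hull_minimal) auto
  with \<open>K \<ge> 0\<close> show ?thesis by blast
qed

lemma has_limit_shape_eventually:
  assumes D: "has_limit_shape a D" and a: "\<And>y. 0 \<le> a y" and "0 < e"
  shows "eventually (\<lambda>t. (\<forall>y\<in>reachable a t x. infdist (y /\<^sub>R t) D < e) \<and>
           (\<forall>q\<in>D. \<exists>y\<in>reachable a t x. dist q (y /\<^sub>R t) < e)) at_top"
proof -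
  let ?A = "\<lambda>t. (\<lambda>y. y /\<^sub>R t) ` reachable a t x"
  have "((\<lambda>t. hausdorff_dist (?A t) D) \<longlongrightarrow> 0) at_top"
    using D unfolding has_limit_shape_def by blast
  then have "eventually (\<lambda>t. hausdorff_dist (?A t) D < ennreal e) at_top"
    using \<open>0 < e\<close> by (intro order_tendstoD(2)) auto
  then show ?thesis
  proof eventually_elim
    case (elim t)
    have "infdist (y /\<^sub>R t) D < e" if "y \<in> reachable a t x" for y
    proof -
      have "ennreal (infdist (y /\<^sub>R t) D) \<le> hausdorff_dist (?A t) D"
        unfolding hausdorff_dist_def using that by (intro max.coboundedI1 SUP_upper imageI)
      also note elim
      finally show ?thesis by (simp add: ennreal_less_iff infdist_nonneg)
    qed
    moreover have "\<exists>y\<in>reachable a t x. dist q (y /\<^sub>R t) < e" if "q \<in> D" for q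
    proof -
      have "ennreal (infdist q (?A t)) \<le> hausdorff_dist (?A t) D"
        unfolding hausdorff_dist_def using that by (intro max.coboundedI2 SUP_upper)
      also note elim
      finally have "infdist q (?A t) < e" by (simp add: ennreal_less_iff infdist_nonneg)
      \<comment> \<open>Since \<open>infdist\<close> to the empty set is 0, a small value yields a
        near point only for a nonempty set.\<close>
      moreover have "?A t \<noteq> {}" using reachable_nonempty[of a t x] a by auto
      ultimately obtain y where "y \<in> ?A t" "dist q y < e"
        using cInf_lessD[of "dist q ` ?A t" e] by (auto simp: infdist_def)
      then show ?thesis by blast
    qed
    ultimately show ?case by blast
  qed
qed

section \<open>Rounding to integer vectors and periodic speeds\<close>

lemma norm_triangle_three:
  fixes u v w :: "'a::real_normed_vector"
  shows "norm (u - v + w) \<le> norm u + norm v + norm w"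
    and "norm (u - v - w) \<le> norm u + norm v + norm w"
  using norm_triangle_ineq[of "u - v" w] norm_triangle_ineq4[of "u - v" w] norm_triangle_ineq4[of u v]
  by linarith+

lemma integer_vector_near:
  fixes x :: "real ^ 'n"
  shows "\<exists>k. (\<forall>i. k $ i \<in> \<int>) \<and> norm (x - k) \<le> real CARD('n)"
proof (intro exI conjI allI)
  let ?k = "(\<chi> i. of_int \<lfloor>x $ i\<rfloor>) :: real ^ 'n"
  show "?k $ i \<in> \<int>" for i by simp
  have "norm (x - ?k) \<le> (\<Sum>i\<in>UNIV. \<bar>(x - ?k) $ i\<bar>)" by (rule norm_le_l1_cart)
  also have "\<dots> \<le> (\<Sum>i\<in>(UNIV :: 'n set). 1)"
    by (intro sum_mono) (simp, linarith)
  finally show "norm (x - ?k) \<le> real CARD('n)" by simp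
qed

lemma Zn_periodic_bounds:
  fixes a :: "real ^ 'n \<Rightarrow> real"
  assumes "continuous_on UNIV a" and pos: "\<And>x. a x > 0" and per: "Zn_periodic a"
  shows "\<exists>m M. 0 < m \<and> (\<forall>x. m \<le> a x \<and> a x \<le> M)"
proof -
  let ?B = "cball 0 (real CARD('n)) :: (real ^ 'n) set"
  have red: "\<exists>y\<in>?B. a x = a y" for x
  proof -
    obtain k :: "real ^ 'n" where k: "\<And>i. k $ i \<in> \<int>" "norm (x - k) \<le> real CARD('n)"
      using integer_vector_near by blast
    have "a (x - k + k) = a (x - k)" using per k(1) unfolding Zn_periodic_def by blast
    with k(2) show ?thesis by (intro bexI[of _ "x - k"]) auto
  qed
  have cont: "continuous_on ?B a" using assms(1) continuous_on_subset by blast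
  have "?B \<noteq> {}" by simp
  obtain y where y: "\<forall>x\<in>?B. a y \<le> a x"
    using continuous_attains_inf[OF compact_cball \<open>?B \<noteq> {}\<close> cont] by blast
  obtain z where z: "\<forall>x\<in>?B. a x \<le> a z"
    using continuous_attains_sup[OF compact_cball \<open>?B \<noteq> {}\<close> cont] by blast
  show ?thesis
    using red y z pos by (intro exI[of _ "a y"] exI[of _ "a z"]) metis
qed

text \<open>Periodicity moves both points into one compact ball, where \<open>a\<close> is uniformly
  continuous; the positive lower bound \<open>m\<close> turns the additive error into a relative
  one.\<close>

lemma Zn_periodic_relatively_uniform:
  fixes a :: "real ^ 'n \<Rightarrow> real"
  assumes "continuous_on UNIV a" and pos: "\<And>x. a x > 0" and per: "Zn_periodic a" and "\<epsilon> > 0"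
  shows "relatively_uniform (\<lambda>x. a (x /\<^sub>R \<epsilon>))"
  unfolding relatively_uniform_def
proof (intro allI impI)
  fix \<eta> :: real assume "\<eta> > 0"
  obtain m where m: "0 < m" "\<And>x. m \<le> a x"
    using Zn_periodic_bounds[OF assms(1-3)] by blast
  \<comment> \<open>The extra 1 leaves room for the second point, which is within
    \<open>\<rho> \<le> 1\<close> of the first.\<close>
  let ?B = "cball 0 (real CARD('n) + 1) :: (real ^ 'n) set"
  have "uniformly_continuous_on ?B a"
    by (rule compact_uniformly_continuous[OF continuous_on_subset[OF assms(1)]]) auto
  moreover have "0 < \<eta> * m" using m(1) \<open>\<eta> > 0\<close> by simp
  ultimately obtain d where d: "d > 0" "\<forall>x\<in>?B. \<forall>y\<in>?B. dist y x < d \<longrightarrow> dist (a y) (a x) < \<eta> * m"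
    unfolding uniformly_continuous_on_def by blast
  define \<rho> where "\<rho> = min (d / 2) 1"
  have \<rho>: "0 < \<rho>" "\<rho> < d" "\<rho> \<le> 1" using d by (auto simp: \<rho>_def)
  have *: "a x \<le> (1 + \<eta>) * a y" if "dist x y \<le> \<rho>" for x y
  proof -
    obtain k :: "real ^ 'n" where k: "\<And>i. k $ i \<in> \<int>" "norm (x - k) \<le> real CARD('n)"
      using integer_vector_near by blast
    have "a (z - k + k) = a (z - k)" for z using per k(1) unfolding Zn_periodic_def by blast
    then have eq: "a (z - k) = a z" for z by simp
    have "norm (y - k) \<le> norm (x - k) + dist x y"
      using norm_triangle_ineq[of "x - k" "y - x"] by (simp add: dist_norm norm_minus_commute)
    then have "dist (a (x - k)) (a (y - k)) < \<eta> * m"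
      using k that \<rho> by (intro d(2)[rule_format]) (auto simp: dist_norm norm_minus_commute)
    then have "a x \<le> a y + \<eta> * m" by (simp add: eq dist_real_def)
    also have "\<dots> \<le> a y + \<eta> * a y" using m \<open>\<eta> > 0\<close> by simp
    finally show ?thesis by (simp add: algebra_simps)
  qed
  show "\<exists>\<rho>>0. \<forall>x y. dist x y \<le> \<rho> \<longrightarrow> a (x /\<^sub>R \<epsilon>) \<le> (1 + \<eta>) * a (y /\<^sub>R \<epsilon>)"
  proof (intro exI[of _ "\<epsilon> * \<rho>"] conjI allI impI *)
    fix x y :: "real ^ 'n" assume "dist x y \<le> \<epsilon> * \<rho>"
    moreover have "x /\<^sub>R \<epsilon> - y /\<^sub>R \<epsilon> = (x - y) /\<^sub>R \<epsilon>"
      by (simp add: scaleR_right_diff_distrib)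
    then have "dist (x /\<^sub>R \<epsilon>) (y /\<^sub>R \<epsilon>) = dist x y / \<epsilon>"
      using \<open>\<epsilon> > 0\<close> by (simp add: dist_norm divide_inverse_commute del: scaleR_right_diff_distrib)
    ultimately show "dist (x /\<^sub>R \<epsilon>) (y /\<^sub>R \<epsilon>) \<le> \<rho>"
      using \<open>\<epsilon> > 0\<close> by (simp add: divide_le_eq mult.commute)
  qed (use \<rho> \<open>\<epsilon> > 0\<close> in simp)
qed

section \<open>Bounded distance between reachable sets and the limit shape\<close>

context
  fixes a :: "real ^ 'n \<Rightarrow> real" and P :: "(real ^ 'n) set" and m M :: real
  assumes m: "0 < m" "\<And>x. m \<le> a x" and M: "\<And>x. a x \<le> M" and per: "Zn_periodic a"
    and shape: "has_limit_shape a P"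
begin

lemma a_nonneg: "0 \<le> a x"
  using m by (meson less_imp_le order_trans)

text \<open>At the minimal speed \<open>m\<close> this time suffices to join a point to the integer
  vector obtained by rounding it.\<close>

definition connect_time :: real where
  "connect_time = real CARD('n) / m"

lemma connect_time_nonneg: "0 \<le> connect_time"
  using m by (simp add: connect_time_def)

lemma reachable_connect: "norm (y - x) \<le> real CARD('n) \<Longrightarrow> y \<in> reachable a connect_time x"
  using m connect_time_nonneg by (intro reachable_segment[of y x m]) (auto simp: connect_time_def)

lemma reachable_integer_translate:
  assumes "\<And>i. k $ i \<in> \<int>" "y \<in> reachable a t x"
  shows "y + k \<in> reachable a t (x + k)"
  using per assms by (intro reachable_translate) (auto simp: Zn_periodic_def)

lemma limit_shape_bounded: obtains B where "0 < B" "\<And>q. q \<in> P \<Longrightarrow> norm q \<le> B"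
  using shape unfolding has_limit_shape_def by (metis bounded_pos compact_imp_bounded)

text \<open>By periodicity, all multiples \<open>n k\<close> are reachable in time \<open>n t\<close>; dividing by \<open>n t\<close> and letting
  \<open>n \<rightarrow> \<infinity>\<close> puts \<open>k / t\<close> itself into the limit shape.\<close>

lemma integer_reachable_in_shape:
  assumes k: "\<And>i. k $ i \<in> \<int>" "k \<in> reachable a t 0" and "0 < t"
  shows "k /\<^sub>R t \<in> P"
proof -
  have multiple: "real n *\<^sub>R k \<in> reachable a (real n * t) 0" for n :: nat
  proof (induction n)
    case 0
    then show ?case using reachable_refl[of 0 a 0] a_nonneg by simp
  next
    case (Suc n)
    have "(real n *\<^sub>R k) $ i \<in> \<int>" for i using k(1) by simp
    from reachable_integer_translate[OF this k(2)]
    have "k + real n *\<^sub>R k \<in> reachable a t (real n *\<^sub>R k)" by simp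
    from reachable_trans[OF Suc.IH this] show ?case
      using \<open>0 < t\<close> by (simp add: algebra_simps)
  qed
  have "infdist (k /\<^sub>R t) P \<le> 0 + e" if e: "e > 0" for e
  proof -
    obtain T where T: "\<And>s. T \<le> s \<Longrightarrow> \<forall>y\<in>reachable a s 0. infdist (y /\<^sub>R s) P < e"
      using has_limit_shape_eventually[OF shape a_nonneg e, of 0] unfolding eventually_at_top_linorder by blast
    \<comment> \<open>The maximum with 1 also excludes \<open>n = 0\<close>.\<close>
    obtain n :: nat where n: "max T 1 / t < real n" using reals_Archimedean2 by blast
    then have nT: "max T 1 < real n * t" using \<open>0 < t\<close> by (simp add: field_simps)
    then have "n \<noteq> 0" by (intro notI) simp
    have less: "infdist ((real n *\<^sub>R k) /\<^sub>R (real n * t)) P < e"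
      by (rule bspec[OF T multiple]) (use nT in simp)
    have eq: "(real n *\<^sub>R k) /\<^sub>R (real n * t) = k /\<^sub>R t"
      using \<open>n \<noteq> 0\<close> by (simp add: field_simps)
    show ?thesis using less unfolding eq by simp
  qed
  then have "infdist (k /\<^sub>R t) P \<le> 0" by (rule field_le_epsilon)
  then have "infdist (k /\<^sub>R t) P = 0" using infdist_nonneg[of "k /\<^sub>R t" P] by linarith
  moreover have "closed P" "P \<noteq> {}"
    using shape compact_imp_closed unfolding has_limit_shape_def by auto
  ultimately show ?thesis by (simp add: in_closed_iff_infdist_zero)
qed

text \<open>Extend the path to an integer vector \<open>k\<close> near its end. Then
  \<open>k\<close> divided by the total time lies in \<open>P\<close> and serves as
  \<open>q\<close>; the rounding and the extra \<open>connect_time\<close> cost a constant.\<close>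

lemma reachable_near_shape_origin:
  obtains C where "\<And>t y. 0 \<le> t \<Longrightarrow> y \<in> reachable a t 0 \<Longrightarrow> \<exists>q\<in>P. norm (y - t *\<^sub>R q) \<le> C"
proof -
  obtain B where B: "0 < B" "\<And>q. q \<in> P \<Longrightarrow> norm q \<le> B" using limit_shape_bounded by blast
  have "\<exists>q\<in>P. norm (y - t *\<^sub>R q) \<le> real CARD('n) + connect_time * B" if "0 \<le> t" "y \<in> reachable a t 0" for t y
  proof -
    obtain k :: "real ^ 'n" where k: "\<And>i. k $ i \<in> \<int>" "norm (y - k) \<le> real CARD('n)"
      using integer_vector_near by blast
    have T: "connect_time > 0" using m by (simp add: connect_time_def)
    have "k \<in> reachable a (t + connect_time) 0"
      using k that connect_time_nonneg
      by (intro reachable_trans[OF that(2)] reachable_connect) (auto simp: norm_minus_commute)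
    then have q: "k /\<^sub>R (t + connect_time) \<in> P"
      using T that by (intro integer_reachable_in_shape k) auto
    define q where "q = k /\<^sub>R (t + connect_time)"
    have "k = (t + connect_time) *\<^sub>R q" using T that by (simp add: q_def)
    then have "y - t *\<^sub>R q = (y - k) + connect_time *\<^sub>R q" by (simp add: algebra_simps)
    then have "norm (y - t *\<^sub>R q) \<le> norm (y - k) + norm (connect_time *\<^sub>R q)"
      by (simp only: norm_triangle_ineq)
    also have "norm (connect_time *\<^sub>R q) = connect_time * norm q" using T by simp
    also have "norm (y - k) + connect_time * norm q \<le> real CARD('n) + connect_time * B"
      using k(2) B(2)[OF q[folded q_def]] T by (intro add_mono mult_left_mono) auto
    finally show ?thesis using q unfolding q_def[symmetric] by blast
  qed
  then show ?thesis using that by blast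
qed

text \<open>A path from \<open>x\<close> is prefixed by a segment from a nearby integer vector, and
  the whole is translated to start at the origin.\<close>

lemma reachable_near_shape:
  obtains C where "\<And>t x y. 0 \<le> t \<Longrightarrow> y \<in> reachable a t x \<Longrightarrow> \<exists>q\<in>P. norm (y - x - t *\<^sub>R q) \<le> C"
proof -
  obtain B where B: "0 < B" "\<And>q. q \<in> P \<Longrightarrow> norm q \<le> B" using limit_shape_bounded by blast
  obtain C where C: "\<And>t y. 0 \<le> t \<Longrightarrow> y \<in> reachable a t 0 \<Longrightarrow> \<exists>q\<in>P. norm (y - t *\<^sub>R q) \<le> C"
    using reachable_near_shape_origin by blast
  have "\<exists>q\<in>P. norm (y - x - t *\<^sub>R q) \<le> C + real CARD('n) + connect_time * B"
    if ty: "0 \<le> t" "y \<in> reachable a t x" for t x y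
  proof -
    obtain k :: "real ^ 'n" where k: "\<And>i. k $ i \<in> \<int>" "norm (x - k) \<le> real CARD('n)"
      using integer_vector_near by blast
    have "y \<in> reachable a (connect_time + t) k"
      using k ty connect_time_nonneg by (intro reachable_trans[OF _ ty(2)] reachable_connect) auto
    from reachable_integer_translate[OF _ this, of "- k"] k
    have "y - k \<in> reachable a (connect_time + t) 0" by simp
    then obtain q where q: "q \<in> P" "norm (y - k - (connect_time + t) *\<^sub>R q) \<le> C"
      using C[of "connect_time + t"] ty connect_time_nonneg by fastforce
    have "y - x - t *\<^sub>R q = (y - k - (connect_time + t) *\<^sub>R q) - (x - k) + connect_time *\<^sub>R q"
      by (simp add: algebra_simps)
    then have "norm (y - x - t *\<^sub>R q) \<le> norm (y - k - (connect_time + t) *\<^sub>R q) + norm (x - k) + norm (connect_time *\<^sub>R q)"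
      by (simp only: norm_triangle_three)
    also have "\<dots> \<le> C + real CARD('n) + connect_time * B"
      using k q B(2)[OF q(1)] connect_time_nonneg by (intro add_mono) (auto intro: mult_left_mono)
    finally show ?thesis using q by blast
  qed
  then show ?thesis using that by blast
qed

text \<open>If every path of duration \<open>t\<close> fell short of \<open>t (p \<bullet> v)\<close> by more than the constant, cutting long paths
  into pieces of duration \<open>t\<close> would keep the limit shape away from \<open>v\<close>.\<close>

lemma reachable_support_origin:
  assumes "v \<in> P" "0 < t"
  shows "\<exists>y\<in>reachable a t 0. t * (p \<bullet> v) - (norm p * (real CARD('n) + M * connect_time) + 1) \<le> p \<bullet> y"
proof (rule ccontr)
  assume neg: "\<not> ?thesis"
  \<comment> \<open>Passing from the origin to an arbitrary start costs at most
    \<open>norm p * (real CARD('n) + M * connect_time)\<close>; the additional 1 in the negated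
    claim survives as a net loss.\<close>
  have step: "p \<bullet> (y - x) \<le> t * (p \<bullet> v) - 1" if y: "y \<in> reachable a t x" for x y
  proof -
    obtain k :: "real ^ 'n" where k: "\<And>i. k $ i \<in> \<int>" "norm (x - k) \<le> real CARD('n)"
      using integer_vector_near by blast
    have "y \<in> reachable a (connect_time + t) k"
      using k \<open>0 < t\<close> connect_time_nonneg by (intro reachable_trans[OF _ y] reachable_connect) auto
    from reachable_integer_translate[OF _ this, of "- k"] k
    have "y - k \<in> reachable a (t + connect_time) 0" by (simp add: add.commute)
    \<comment> \<open>The prefixed path is cut after time \<open>t\<close>, not after
      \<open>connect_time\<close>, so that the negated claim applies to \<open>z\<close>.\<close>
    then obtain z where z: "z \<in> reachable a t 0" "y - k \<in> reachable a connect_time z"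
      using reachable_split \<open>0 < t\<close> connect_time_nonneg by (metis less_imp_le)
    have "norm (y - k - z) \<le> M * connect_time"
      using reachable_norm_le[OF z(2) connect_time_nonneg M] .
    then have n: "norm ((y - k - z) + (k - x)) \<le> M * connect_time + real CARD('n)"
      using k(2) norm_triangle_ineq[of "y - k - z" "k - x"] by (simp add: norm_minus_commute)
    have "p \<bullet> ((y - k - z) + (k - x)) \<le> norm p * norm ((y - k - z) + (k - x))"
      by (rule norm_cauchy_schwarz)
    also have "\<dots> \<le> norm p * (M * connect_time + real CARD('n))"
      by (rule mult_left_mono[OF n norm_ge_zero])
    finally have "p \<bullet> (y - x) \<le> p \<bullet> z + norm p * (real CARD('n) + M * connect_time)"
      by (simp add: inner_diff_right inner_add_right add.commute)
    moreover have "p \<bullet> z < t * (p \<bullet> v) - (norm p * (real CARD('n) + M * connect_time) + 1)"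
      using neg z(1) by (auto simp: not_le)
    ultimately show ?thesis by linarith
  qed
  have chain: "p \<bullet> (y - x) \<le> real n * (t * (p \<bullet> v) - 1)" if "y \<in> reachable a (real n * t) x" for n x y
    using that
  proof (induction n arbitrary: x)
    case 0
    then have "y = x" by (auto simp: reachable_def)
    then show ?case by simp
  next
    case (Suc n)
    have "real (Suc n) * t = t + real n * t" by (simp add: algebra_simps)
    then obtain z where z: "z \<in> reachable a t x" "y \<in> reachable a (real n * t) z"
      using reachable_split[of y a t "real n * t" x] Suc.prems \<open>0 < t\<close> by auto
    have "p \<bullet> (y - x) = p \<bullet> (y - z) + p \<bullet> (z - x)" by (simp add: inner_diff_right)
    also have "\<dots> \<le> real n * (t * (p \<bullet> v) - 1) + (t * (p \<bullet> v) - 1)"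
      using Suc.IH[OF z(2)] step[OF z(1)] by (rule add_mono)
    finally show ?case by (simp add: algebra_simps)
  qed
  \<comment> \<open>After \<open>n\<close> pieces the loss is \<open>n\<close>, whereas precision
    \<open>e\<close> at time \<open>n * t\<close> allows a loss of at most
    \<open>n * t * norm p * e\<close>, which is less than \<open>n\<close>.\<close>
  define e where "e = 1 / (t * (norm p + 1))"
  have "e > 0" using \<open>0 < t\<close> by (simp add: e_def add_nonneg_pos)
  obtain T where T: "\<And>s. T \<le> s \<Longrightarrow> \<forall>q\<in>P. \<exists>y\<in>reachable a s 0. dist q (y /\<^sub>R s) < e"
    using has_limit_shape_eventually[OF shape a_nonneg \<open>e > 0\<close>, of 0]
    unfolding eventually_at_top_linorder by blast
  obtain n :: nat where "max T 1 / t < real n" using reals_Archimedean2 by blast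
  then have nT: "max T 1 < real n * t" using \<open>0 < t\<close> by (simp add: field_simps)
  then obtain y where y: "y \<in> reachable a (real n * t) 0" "dist v (y /\<^sub>R (real n * t)) < e"
    using T[of "real n * t"] \<open>v \<in> P\<close> by fastforce
  define s where "s = real n * t"
  have s: "s > 0" using nT by (simp add: s_def)
  have "p \<bullet> (v - y /\<^sub>R s) \<le> norm p * norm (v - y /\<^sub>R s)" by (rule norm_cauchy_schwarz)
  also have "\<dots> \<le> norm p * e" using y(2) by (intro mult_left_mono) (auto simp: dist_norm s_def)
  also have "\<dots> < 1 / t"
    using \<open>0 < t\<close> by (simp add: e_def divide_simps add_nonneg_pos)
  finally have "s * (p \<bullet> (v - y /\<^sub>R s)) < s * (1 / t)" using s by (rule mult_strict_left_mono)
  moreover have "s * (p \<bullet> (v - y /\<^sub>R s)) = s * (p \<bullet> v) - p \<bullet> y"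
    using s by (simp add: inner_diff_right right_diff_distrib)
  moreover have "s * (1 / t) = real n" using \<open>0 < t\<close> by (simp add: s_def)
  ultimately have "s * (p \<bullet> v) - p \<bullet> y < real n" by simp
  moreover have "p \<bullet> y \<le> s * (p \<bullet> v) - real n"
    using chain[OF y(1)] by (simp add: s_def right_diff_distrib mult.assoc)
  ultimately show False by simp
qed

text \<open>A path almost optimal in the exposing direction \<open>p\<close> ends near some
  \<open>t *\<^sub>R q\<close> with \<open>q \<in> P\<close>, so
  \<open>t * (p \<bullet> (v - q))\<close> is bounded. The linear bound at the vertex then bounds
  \<open>t * norm (v - q)\<close>, and periodicity transfers the result to every start.\<close>

lemma reachable_near_vertex:
  assumes "polytope P" "v extreme_point_of P"
  obtains C where "0 \<le> C" "\<And>t x. 0 \<le> t \<Longrightarrow> \<exists>y\<in>reachable a t x. norm (y - x - t *\<^sub>R v) \<le> C"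
proof -
  have "v \<in> P" using assms(2) by (simp add: extreme_point_of_def)
  obtain p K where K: "0 \<le> K" "\<And>q. q \<in> P \<Longrightarrow> norm (v - q) \<le> K * (p \<bullet> (v - q))"
    using extreme_point_of_polytope_linear_bound[OF assms] by blast
  obtain C where C: "\<And>t y. 0 \<le> t \<Longrightarrow> y \<in> reachable a t 0 \<Longrightarrow> \<exists>q\<in>P. norm (y - t *\<^sub>R q) \<le> C"
    using reachable_near_shape_origin by blast
  define C1 where "C1 = norm p * (real CARD('n) + M * connect_time) + 1"
  define C2 where "C2 = C + K * (C1 + norm p * C)"
  have "0 \<in> reachable a 0 0" using reachable_refl[of 0 a 0] a_nonneg by simp
  then obtain q0 where "norm (0 - 0 *\<^sub>R q0 :: real ^ 'n) \<le> C" using C[of 0 0] by auto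
  then have "0 \<le> C" by simp
  have "0 \<le> M" using m(1,2) M by (meson less_imp_le order_trans)
  then have "0 \<le> C1" using connect_time_nonneg by (simp add: C1_def)
  then have "0 \<le> C2" using K \<open>0 \<le> C\<close> by (simp add: C2_def)
  have origin: "\<exists>y\<in>reachable a t 0. norm (y - t *\<^sub>R v) \<le> C2" if t: "0 \<le> t" for t
  proof (cases "t = 0")
    case True
    then show ?thesis using \<open>0 \<in> reachable a 0 0\<close> \<open>0 \<le> C2\<close> by (intro bexI[of _ 0]) auto
  next
    case False
    with t have "0 < t" by simp
    then obtain y where y: "y \<in> reachable a t 0" "t * (p \<bullet> v) - C1 \<le> p \<bullet> y"
      using reachable_support_origin[OF \<open>v \<in> P\<close>] unfolding C1_def by blast
    obtain q where q: "q \<in> P" "norm (y - t *\<^sub>R q) \<le> C" using C[OF t y(1)] by blast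
    have "p \<bullet> (y - t *\<^sub>R q) \<le> norm p * C"
      using norm_cauchy_schwarz[of p "y - t *\<^sub>R q"] mult_left_mono[OF q(2) norm_ge_zero[of p]] by linarith
    then have "t * (p \<bullet> (v - q)) \<le> C1 + norm p * C"
      using y(2) by (simp add: inner_diff_right right_diff_distrib)
    then have "K * (t * (p \<bullet> (v - q))) \<le> K * (C1 + norm p * C)"
      using K by (intro mult_left_mono) auto
    moreover have "t * norm (v - q) \<le> t * (K * (p \<bullet> (v - q)))"
      using K(2)[OF q(1)] that by (rule mult_left_mono)
    ultimately have "t * norm (v - q) \<le> K * (C1 + norm p * C)"
      by (simp add: mult.left_commute)
    moreover have "norm (y - t *\<^sub>R v) \<le> norm (y - t *\<^sub>R q) + t * norm (v - q)"
    proof -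
      have "y - t *\<^sub>R v = (y - t *\<^sub>R q) - t *\<^sub>R (v - q)" by (simp add: algebra_simps)
      then have "norm (y - t *\<^sub>R v) \<le> norm (y - t *\<^sub>R q) + norm (t *\<^sub>R (v - q))"
        by (simp only: norm_triangle_ineq4)
      then show ?thesis using t by simp
    qed
    ultimately have "norm (y - t *\<^sub>R v) \<le> C2" using q(2) by (simp add: C2_def)
    with y(1) show ?thesis by blast
  qed
  define C3 where "C3 = C2 + real CARD('n) + connect_time * norm v"
  have "\<exists>y\<in>reachable a t x. norm (y - x - t *\<^sub>R v) \<le> C3" if "0 \<le> t" for t x
  \<comment> \<open>For short times it is enough to stay at \<open>x\<close>; otherwise
    \<open>connect_time\<close> is spent on reaching an integer vector.\<close>
  proof (cases "t \<le> connect_time")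
    case True
    then have "t * norm v \<le> connect_time * norm v" by (simp add: mult_right_mono)
    then have "norm (x - x - t *\<^sub>R v) \<le> C3" using that \<open>0 \<le> C2\<close> by (simp add: C3_def)
    with reachable_refl[of t a x] that a_nonneg show ?thesis by blast
  next
    case False
    obtain k :: "real ^ 'n" where k: "\<And>i. k $ i \<in> \<int>" "norm (x - k) \<le> real CARD('n)"
      using integer_vector_near by blast
    obtain y where y: "y \<in> reachable a (t - connect_time) 0" "norm (y - (t - connect_time) *\<^sub>R v) \<le> C2"
      using origin[of "t - connect_time"] False by auto
    have "k \<in> reachable a connect_time x"
      using k by (intro reachable_connect) (simp add: norm_minus_commute)
    from reachable_trans[OF this, of "y + k" "t - connect_time"]
      reachable_integer_translate[OF k(1) y(1)] connect_time_nonneg False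
    have mem: "y + k \<in> reachable a t x" by simp
    have "y + k - x - t *\<^sub>R v = (y - (t - connect_time) *\<^sub>R v) - (x - k) - connect_time *\<^sub>R v"
      by (simp add: algebra_simps)
    then have "norm (y + k - x - t *\<^sub>R v) \<le> norm (y - (t - connect_time) *\<^sub>R v) + norm (x - k) + norm (connect_time *\<^sub>R v)"
      by (simp only: norm_triangle_three)
    also have "\<dots> \<le> C3"
      using y(2) k(2) connect_time_nonneg by (simp add: C3_def)
    finally show ?thesis using mem by blast
  qed
  moreover have "0 \<le> C3" using \<open>0 \<le> C2\<close> connect_time_nonneg by (simp add: C3_def)
  ultimately show ?thesis using that by blast
qed

text \<open>A convex combination of vertices is followed one vertex after another, with times
  proportional to the weights. Each vertex contributes its own constant once, so the total error is
  independent of \<open>t\<close>.\<close>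

lemma shape_near_reachable:
  assumes "polytope P"
  obtains C where "\<And>t x q. 0 \<le> t \<Longrightarrow> q \<in> P \<Longrightarrow> \<exists>y\<in>reachable a t x. norm (y - x - t *\<^sub>R q) \<le> C"
proof -
  define V where "V = {v. v extreme_point_of P}"
  obtain S where S: "finite S" "P = convex hull S"
    using assms unfolding polytope_def by blast
  have V: "finite V" "P = convex hull V"
    using finite_subset[OF _ S(1)] extreme_points_of_convex_hull[of S] Krein_Milman_polytope[OF S(1)] S(2)
    by (auto simp: V_def)
  have "\<forall>v\<in>V. \<exists>C\<ge>0. \<forall>t x. 0 \<le> t \<longrightarrow> (\<exists>y\<in>reachable a t x. norm (y - x - t *\<^sub>R v) \<le> C)"
    using reachable_near_vertex[OF assms] unfolding V_def by (metis mem_Collect_eq)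
  then obtain c where c: "\<And>v. v \<in> V \<Longrightarrow> 0 \<le> c v"
    "\<And>v t x. v \<in> V \<Longrightarrow> 0 \<le> t \<Longrightarrow> \<exists>y\<in>reachable a t x. norm (y - x - t *\<^sub>R v) \<le> c v"
    by metis
  \<comment> \<open>The start \<open>x\<close> must be arbitrary in the induction, since each piece
    begins where the previous one ended.\<close>
  have comb: "\<exists>y\<in>reachable a (\<Sum>v\<in>W. l v) x. norm (y - x - (\<Sum>v\<in>W. l v *\<^sub>R v)) \<le> (\<Sum>v\<in>W. c v)"
    if "finite W" "W \<subseteq> V" "\<And>v. v \<in> W \<Longrightarrow> 0 \<le> l v" for W l x
    using that
  proof (induction W arbitrary: x rule: finite_induct)
    case empty
    then show ?case using reachable_refl[of 0 a x] a_nonneg by auto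
  next
    case (insert v W)
    obtain z where z: "z \<in> reachable a (l v) x" "norm (z - x - l v *\<^sub>R v) \<le> c v"
      using c(2)[of v "l v" x] insert.prems by auto
    obtain y where y: "y \<in> reachable a (\<Sum>v\<in>W. l v) z" "norm (y - z - (\<Sum>v\<in>W. l v *\<^sub>R v)) \<le> (\<Sum>v\<in>W. c v)"
      using insert.IH[of z] insert.prems by auto
    have "y \<in> reachable a (l v + (\<Sum>v\<in>W. l v)) x"
      using insert.prems by (intro reachable_trans[OF z(1) y(1)] sum_nonneg) auto
    moreover have "norm ((z - x - l v *\<^sub>R v) + (y - z - (\<Sum>v\<in>W. l v *\<^sub>R v))) \<le> c v + (\<Sum>v\<in>W. c v)"
      using norm_triangle_mono[OF z(2) y(2)] .
    then have "norm (y - x - (l v *\<^sub>R v + (\<Sum>v\<in>W. l v *\<^sub>R v))) \<le> c v + (\<Sum>v\<in>W. c v)"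
      by (simp add: algebra_simps)
    ultimately show ?case using insert.hyps by auto
  qed
  have "\<exists>y\<in>reachable a t x. norm (y - x - t *\<^sub>R q) \<le> (\<Sum>v\<in>V. c v)" if t: "0 \<le> t" and q: "q \<in> P" for t x q
  proof -
    obtain l where l: "\<And>v. v \<in> V \<Longrightarrow> 0 \<le> l v" "sum l V = 1" "(\<Sum>v\<in>V. l v *\<^sub>R v) = q"
      using q V by (auto simp: convex_hull_finite)
    have "(\<Sum>v\<in>V. t * l v) = t" "(\<Sum>v\<in>V. (t * l v) *\<^sub>R v) = t *\<^sub>R q"
      using l by (simp_all add: sum_distrib_left[symmetric] scaleR_sum_right[symmetric] scaleR_scaleR[symmetric] del: scaleR_scaleR)
    then show ?thesis using comb[OF V(1) subset_refl, of "\<lambda>v. t * l v" x] l t by simp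
  qed
  then show ?thesis using that by blast
qed

end

section \<open>The rate of convergence\<close>

lemma le_of_le_plus_vanishing:
  fixes X Y :: real and f :: "real \<Rightarrow> real"
  assumes "\<And>\<eta>. 0 < \<eta> \<Longrightarrow> X \<le> Y + f \<eta>" and "(f \<longlongrightarrow> 0) (at_right 0)"
  shows "X \<le> Y"
proof -
  have "((\<lambda>\<eta>. Y + f \<eta>) \<longlongrightarrow> Y + 0) (at_right 0)" by (intro tendsto_intros assms)
  moreover have "eventually (\<lambda>\<eta>. X \<le> Y + f \<eta>) (at_right 0)"
    using eventually_at_right_less[of 0] by (rule eventually_mono) (rule assms(1))
  ultimately show ?thesis using tendsto_lowerbound[of _ _ "at_right (0::real)"] by fastforce
qed

lemma reachable_rescale_iff:
  fixes a :: "'a::euclidean_space \<Rightarrow> real"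
  assumes "\<epsilon> > 0"
  shows "y \<in> reachable (\<lambda>x. a (x /\<^sub>R \<epsilon>)) t x \<longleftrightarrow> y /\<^sub>R \<epsilon> \<in> reachable a (t / \<epsilon>) (x /\<^sub>R \<epsilon>)"
proof
  assume "y \<in> reachable (\<lambda>x. a (x /\<^sub>R \<epsilon>)) t x"
  from reachable_scale[OF this, of "inverse \<epsilon>" a]
  show "y /\<^sub>R \<epsilon> \<in> reachable a (t / \<epsilon>) (x /\<^sub>R \<epsilon>)"
    using assms by (simp add: divide_inverse_commute)
next
  assume "y /\<^sub>R \<epsilon> \<in> reachable a (t / \<epsilon>) (x /\<^sub>R \<epsilon>)"
  from reachable_scale[OF this, of \<epsilon> "\<lambda>x. a (x /\<^sub>R \<epsilon>)"]
  show "y \<in> reachable (\<lambda>x. a (x /\<^sub>R \<epsilon>)) t x"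
    using assms by simp
qed

lemma rescaled_shape_distance:
  fixes x y q :: "'a::real_normed_vector"
  assumes "\<epsilon> > 0"
  shows "norm (y /\<^sub>R \<epsilon> - x /\<^sub>R \<epsilon> - (t / \<epsilon>) *\<^sub>R q) \<le> C \<longleftrightarrow> norm (y - x - t *\<^sub>R q) \<le> C * \<epsilon>"
proof -
  have "y /\<^sub>R \<epsilon> - x /\<^sub>R \<epsilon> - (t / \<epsilon>) *\<^sub>R q = (y - x - t *\<^sub>R q) /\<^sub>R \<epsilon>"
    by (simp add: scaleR_right_diff_distrib divide_inverse_commute)
  then have "norm (y /\<^sub>R \<epsilon> - x /\<^sub>R \<epsilon> - (t / \<epsilon>) *\<^sub>R q) = norm (y - x - t *\<^sub>R q) / \<epsilon>"
    using assms by (simp add: divide_inverse_commute del: scaleR_right_diff_distrib)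
  then show ?thesis using assms by (simp add: pos_divide_le_eq)
qed

text \<open>The Hopf-Lax formula evaluates \<open>g\<close> at \<open>x - t *\<^sub>R q\<close>,
  while paths end near \<open>x + t *\<^sub>R q\<close>; the symmetry of \<open>P\<close> reconciles
  the signs. Points within \<open>R\<close> of each other change \<open>g\<close> by at most
  \<open>L * R\<close>.\<close>

lemma homogenization_pointwise:
  fixes b :: "'a::euclidean_space \<Rightarrow> real" and P :: "'a set"
  assumes P: "compact P" "convex P" "P \<noteq> {}" "uminus ` P = P"
    and b: "\<And>x. 0 < b x" "\<And>x. b x \<le> M" "relatively_uniform b"
    and upper: "\<And>t x y. 0 \<le> t \<Longrightarrow> y \<in> reachable b t x \<Longrightarrow> \<exists>q\<in>P. norm (y - x - t *\<^sub>R q) \<le> R"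
    and lower: "\<And>t x q. 0 \<le> t \<Longrightarrow> q \<in> P \<Longrightarrow> \<exists>y\<in>reachable b t x. norm (y - x - t *\<^sub>R q) \<le> R"
    and g: "L-lipschitz_on UNIV g"
    and u: "cauchy_viscosity_solution (\<lambda>x p. support_function P p) g u"
    and ub: "cauchy_viscosity_solution (\<lambda>x p. b x * norm p) g ub"
    and "0 < t"
  shows "\<bar>ub (x, t) - u (x, t)\<bar> \<le> L * R"
proof -
  have neg: "- q \<in> P" if "q \<in> P" for q using P(4) that by blast
  obtain q0 where "q0 \<in> P" using P(3) by blast
  \<comment> \<open>The origin is the midpoint of \<open>q0\<close> and \<open>- q0\<close>.\<close>
  have "0 \<in> P"
    using convexD[OF P(2) \<open>q0 \<in> P\<close> neg[OF \<open>q0 \<in> P\<close>], of "1/2" "1/2"] by simp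
  obtain B where B: "0 < B" "\<And>q. q \<in> P \<Longrightarrow> norm q \<le> B"
    using P(1) by (metis bounded_pos compact_imp_bounded)
  have "0 \<le> L" by (rule lipschitz_on_nonneg[OF g])
  have glip: "g y \<le> g z + L * norm (y - z)" for y z
    using lipschitz_onD[OF g, of y z] by (simp add: dist_norm)
  have u': "continuous_on (UNIV \<times> {0..}) u"
    "viscosity_subsolution (\<lambda>(x, t) (p, \<tau>). \<tau> + support_function P p) (UNIV \<times> {0<..}) u"
    "viscosity_supersolution (\<lambda>(x, t) (p, \<tau>). \<tau> + support_function P p) (UNIV \<times> {0<..}) u"
    "\<And>x. u (x, 0) = g x"
    using u unfolding cauchy_viscosity_solution_def viscosity_solution_def by blast+
  have ub': "continuous_on (UNIV \<times> {0..}) ub"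
    "viscosity_subsolution (\<lambda>(x, t) (p, \<tau>). \<tau> + b x * norm p) (UNIV \<times> {0<..}) ub"
    "viscosity_supersolution (\<lambda>(x, t) (p, \<tau>). \<tau> + b x * norm p) (UNIV \<times> {0<..}) ub"
    "\<And>x. ub (x, 0) = g x"
    using ub unfolding cauchy_viscosity_solution_def viscosity_solution_def by blast+
  \<comment> \<open>The Hopf-Lax minimiser for \<open>u\<close> gives a direction \<open>- q\<close>
    in the shape, and a reachable point near \<open>x - t *\<^sub>R q\<close> bounds
    \<open>ub\<close> from above.\<close>
  have "ub (x, t) \<le> u (x, t) + L * R"
  proof (rule le_of_le_plus_vanishing)
    show "((\<lambda>\<eta>. L * (\<eta> * t * B)) \<longlongrightarrow> 0) (at_right 0)"
      by (auto intro!: tendsto_eq_intros)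
    fix \<eta> :: real assume \<eta>: "0 < \<eta>"
    obtain q where q: "q \<in> P" "g (x - ((1 + \<eta>) * t) *\<^sub>R q) \<le> u (x, t)"
      using Hopf_Lax_ge[OF P(1,2) \<open>0 \<in> P\<close> u'(1,3) \<open>0 < t\<close> \<eta>] unfolding u'(4) by blast
    obtain y where y: "y \<in> reachable b t x" "norm (y - x - t *\<^sub>R (- q)) \<le> R"
      using lower[OF less_imp_le[OF \<open>0 < t\<close>] neg[OF q(1)]] by blast
    have "ub (x, t) \<le> g y"
      using subsolution_le_reachable[OF b ub'(1,2) y(1) \<open>0 < t\<close>] unfolding ub'(4) .
    also have "g y \<le> g (x - ((1 + \<eta>) * t) *\<^sub>R q) + L * norm (y - (x - ((1 + \<eta>) * t) *\<^sub>R q))"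
      by (rule glip)
    also have "norm (y - (x - ((1 + \<eta>) * t) *\<^sub>R q)) \<le> R + \<eta> * t * B"
    proof -
      have "y - (x - ((1 + \<eta>) * t) *\<^sub>R q) = (y - x - t *\<^sub>R (- q)) + (\<eta> * t) *\<^sub>R q"
        by (simp add: algebra_simps)
      then have "norm (y - (x - ((1 + \<eta>) * t) *\<^sub>R q)) \<le> norm (y - x - t *\<^sub>R (- q)) + norm ((\<eta> * t) *\<^sub>R q)"
        by (simp only: norm_triangle_ineq)
      also have "norm ((\<eta> * t) *\<^sub>R q) \<le> \<eta> * t * B"
        using B(2)[OF q(1)] \<eta> \<open>0 < t\<close> by simp
      finally show ?thesis using y(2) by linarith
    qed
    finally show "ub (x, t) \<le> u (x, t) + L * R + L * (\<eta> * t * B)"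
      using q(2) \<open>0 \<le> L\<close> by (simp add: mult_left_mono distrib_left)
  qed
  \<comment> \<open>The point \<open>y\<close> that bounds \<open>ub\<close> from below is reached
    in the slightly longer time \<open>s\<close>; going back from \<open>s\<close> to
    \<open>t\<close> costs \<open>(s - t) * B\<close>, which vanishes with
    \<open>\<eta>\<close>.\<close>
  moreover have "u (x, t) \<le> ub (x, t) + L * R"
  proof (rule le_of_le_plus_vanishing)
    show "((\<lambda>\<eta>. L * (((1 + \<eta>) ^ 3 - 1) * t * B)) \<longlongrightarrow> 0) (at_right 0)"
      by (auto intro!: tendsto_eq_intros)
    fix \<eta> :: real assume \<eta>: "0 < \<eta>"
    define s where "s = (1 + \<eta>) ^ 3 * t"
    have st: "0 \<le> s - t" "s - t = ((1 + \<eta>) ^ 3 - 1) * t"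
      using \<eta> \<open>0 < t\<close> by (auto simp: s_def algebra_simps mult_le_cancel_right1)
    obtain y where y: "y \<in> reachable b s x" "g y \<le> ub (x, t)"
      using supersolution_ge_reachable[OF b ub'(1,3) \<open>0 < t\<close> \<eta>] unfolding ub'(4) s_def by blast
    obtain q where q: "q \<in> P" "norm (y - x - s *\<^sub>R q) \<le> R"
      using upper[OF _ y(1)] st \<open>0 < t\<close> by fastforce
    have "u (x, t) \<le> g (x - t *\<^sub>R (- q))"
      using Hopf_Lax_le[OF P(1) neg[OF q(1)] u'(1,2) \<open>0 < t\<close>] unfolding u'(4) .
    also have "\<dots> \<le> g y + L * norm (x - t *\<^sub>R (- q) - y)" by (rule glip)
    also have "norm (x - t *\<^sub>R (- q) - y) \<le> R + (s - t) * B"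
    proof -
      have "x - t *\<^sub>R (- q) - y = - ((y - x - s *\<^sub>R q) + (s - t) *\<^sub>R q)"
        by (simp add: algebra_simps)
      then have "norm (x - t *\<^sub>R (- q) - y) \<le> norm (y - x - s *\<^sub>R q) + norm ((s - t) *\<^sub>R q)"
        by (simp only: norm_triangle_ineq norm_minus_cancel)
      also have "norm ((s - t) *\<^sub>R q) \<le> (s - t) * B"
        using B(2)[OF q(1)] st(1) by (simp add: mult_left_mono)
      finally show ?thesis using q(2) by linarith
    qed
    finally show "u (x, t) \<le> ub (x, t) + L * R + L * (((1 + \<eta>) ^ 3 - 1) * t * B)"
      using y(2) \<open>0 \<le> L\<close> by (simp add: mult_left_mono distrib_left st(2))
  qed
  ultimately show ?thesis by linarith
qed

lemma Linfty_norm_le: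
  fixes f :: "'a::euclidean_space \<Rightarrow> real"
  assumes "closed S" "continuous_on S f" "\<And>z. z \<in> S \<Longrightarrow> \<bar>f z\<bar> \<le> c"
  shows "Linfty_norm S f \<le> ereal c"
  unfolding Linfty_norm_def
proof (rule esssup_I)
  \<comment> \<open>Continuity on a closed set supplies the measurability required by
    \<open>esssup_I\<close>.\<close>
  have "continuous_on S (\<lambda>z. \<bar>f z\<bar>)" by (intro continuous_intros assms)
  then have "(\<lambda>z. \<bar>f z\<bar>) \<in> borel_measurable (lebesgue_on S)"
    using assms(1) by (intro continuous_imp_measurable_on_sets_lebesgue) auto
  then show "(\<lambda>z. ereal \<bar>f z\<bar>) \<in> borel_measurable (lebesgue_on S)"
    by (rule borel_measurable_ereal)
  show "AE z in lebesgue_on S. ereal \<bar>f z\<bar> \<le> ereal c"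
    using assms(3) by (intro AE_I2) simp
qed

text \<open>The distance bounds are established once, at scale one, so \<open>C\<close> is fixed
  before \<open>g\<close>, \<open>L\<close> and \<open>\<epsilon>\<close>. Rescaling space and time
  turns them into \<open>C * \<epsilon>\<close>, and the Lipschitz constant of \<open>g\<close>
  enters as the factor \<open>L\<close>.\<close>

theorem theorem1p4:
  fixes a :: "real ^ 'n \<Rightarrow> real" and P :: "(real ^ 'n) set"
  assumes "polytope P" and "uminus ` P = P" and "interior P \<noteq> {}"
    and "continuous_on UNIV a" and "\<And>x. a x > 0" and "Zn_periodic a"
    and "\<not> a constant_on UNIV"
    and "has_limit_shape a P"
  shows "\<exists>C>0. \<forall>g L u. bounded (range g) \<longrightarrow> L-lipschitz_on UNIV g \<longrightarrow>
           cauchy_viscosity_solution (\<lambda>x p. support_function (limit_shape a) p) g u \<longrightarrow>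
           (\<forall>\<epsilon>\<in>{0<..<1}. \<forall>u\<^sub>\<epsilon>.
              cauchy_viscosity_solution (\<lambda>x p. a (x /\<^sub>R \<epsilon>) * norm p) g u\<^sub>\<epsilon> \<longrightarrow>
              Linfty_norm (UNIV \<times> {0..}) (\<lambda>z. u\<^sub>\<epsilon> z - u z) \<le> ereal (C * L * \<epsilon>))"
proof -
  have limit: "limit_shape a = P"
    using assms(5,8) by (intro limit_shape_eq) (auto intro: less_imp_le)
  have P: "compact P" "convex P" "P \<noteq> {}"
    using assms(8) unfolding has_limit_shape_def by auto
  obtain m M where m: "0 < m" "\<And>x. m \<le> a x" and M: "\<And>x. a x \<le> M"
    using Zn_periodic_bounds[OF assms(4-6)] by blast
  obtain C1 where C1: "\<And>t x y. 0 \<le> t \<Longrightarrow> y \<in> reachable a t x \<Longrightarrow> \<exists>q\<in>P. norm (y - x - t *\<^sub>R q) \<le> C1"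
    using reachable_near_shape[OF m M assms(6,8)] by blast
  obtain C2 where C2: "\<And>t x q. 0 \<le> t \<Longrightarrow> q \<in> P \<Longrightarrow> \<exists>y\<in>reachable a t x. norm (y - x - t *\<^sub>R q) \<le> C2"
    using shape_near_reachable[OF m M assms(6,8,1)] by blast
  \<comment> \<open>The 1 makes the constant positive.\<close>
  define C where "C = max 1 (max C1 C2)"
  have C: "0 < C" "C1 \<le> C" "C2 \<le> C" by (auto simp: C_def)
  show ?thesis
  proof (intro exI[of _ C] conjI allI impI ballI)
    fix g :: "real ^ 'n \<Rightarrow> real" and L u \<epsilon> u\<^sub>\<epsilon>
    assume g: "L-lipschitz_on UNIV g"
      and u: "cauchy_viscosity_solution (\<lambda>x p. support_function (limit_shape a) p) g u"
      and "\<epsilon> \<in> {0<..<1}"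
      and ue: "cauchy_viscosity_solution (\<lambda>x p. a (x /\<^sub>R \<epsilon>) * norm p) g u\<^sub>\<epsilon>"
    have \<epsilon>: "0 < \<epsilon>" using \<open>\<epsilon> \<in> {0<..<1}\<close> by simp
    have upper: "\<exists>q\<in>P. norm (y - x - t *\<^sub>R q) \<le> C * \<epsilon>"
      if ty: "0 \<le> t" "y \<in> reachable (\<lambda>x. a (x /\<^sub>R \<epsilon>)) t x" for t x y
    proof -
      obtain q where "q \<in> P" "norm (y /\<^sub>R \<epsilon> - x /\<^sub>R \<epsilon> - (t / \<epsilon>) *\<^sub>R q) \<le> C1"
        using C1[OF _ ty(2)[unfolded reachable_rescale_iff[OF \<epsilon>]]] ty(1) \<epsilon> by auto
      then show ?thesis
        using C(2) rescaled_shape_distance[OF \<epsilon>] by (meson order_trans)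
    qed
    have lower: "\<exists>y\<in>reachable (\<lambda>x. a (x /\<^sub>R \<epsilon>)) t x. norm (y - x - t *\<^sub>R q) \<le> C * \<epsilon>"
      if tq: "0 \<le> t" "q \<in> P" for t x q
    proof -
      have "0 \<le> t / \<epsilon>" using tq \<epsilon> by simp
      then obtain y where y: "y \<in> reachable a (t / \<epsilon>) (x /\<^sub>R \<epsilon>)"
        "norm (y - x /\<^sub>R \<epsilon> - (t / \<epsilon>) *\<^sub>R q) \<le> C2"
        using C2[OF _ tq(2)] by blast
      have eq: "(\<epsilon> *\<^sub>R y) /\<^sub>R \<epsilon> = y" using \<epsilon> by simp
      have "\<epsilon> *\<^sub>R y \<in> reachable (\<lambda>x. a (x /\<^sub>R \<epsilon>)) t x"
        unfolding reachable_rescale_iff[OF \<epsilon>] eq by (rule y(1))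
      moreover have "norm (\<epsilon> *\<^sub>R y - x - t *\<^sub>R q) \<le> C * \<epsilon>"
        unfolding rescaled_shape_distance[OF \<epsilon>, symmetric] eq using y(2) C(3) by linarith
      ultimately show ?thesis by blast
    qed
    have cont: "continuous_on (UNIV \<times> {0..}) (\<lambda>z. u\<^sub>\<epsilon> z - u z)"
      using u ue unfolding cauchy_viscosity_solution_def by (intro continuous_intros) auto
    show "Linfty_norm (UNIV \<times> {0..}) (\<lambda>z. u\<^sub>\<epsilon> z - u z) \<le> ereal (C * L * \<epsilon>)"
    proof (rule Linfty_norm_le[OF _ cont])
      show "closed (UNIV \<times> {0..} :: ((real ^ 'n) \<times> real) set)" by (intro closed_Times) auto
      fix z :: "(real ^ 'n) \<times> real" assume "z \<in> UNIV \<times> {0..}"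
      then obtain x t where z: "z = (x, t)" "0 \<le> t" by auto
      have "\<bar>u\<^sub>\<epsilon> (x, t) - u (x, t)\<bar> \<le> L * (C * \<epsilon>)"
      proof (cases "t = 0")
        case True
        then show ?thesis
          using u ue C(1) \<epsilon> lipschitz_on_nonneg[OF g] by (simp add: cauchy_viscosity_solution_def)
      next
        case False
        show ?thesis
        proof (rule homogenization_pointwise[OF P assms(2) _ _ _ upper lower g u[unfolded limit] ue])
          show "relatively_uniform (\<lambda>x. a (x /\<^sub>R \<epsilon>))"
            by (rule Zn_periodic_relatively_uniform[OF assms(4-6) \<epsilon>])
        qed (use assms(5) M False z(2) in auto)
      qed
      then show "\<bar>u\<^sub>\<epsilon> z - u z\<bar> \<le> C * L * \<epsilon>" using z(1) by (simp add: ac_simps)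
    qed
  qed (rule C)
qed

end
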